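(* $\tau(\log F_4^* )>1$; that is, the set $\log F_4^*=\{\log x : x\in F_4^*\}$ has thickness greater than $1$.
   Context: $F_4^*$ is the set of all irrational numbers $x=[x_0;x_1,x_2,\dots]$ (infinite regular continued fractions) such that $(x_0,x_1)=(4,3)$ and, for all $i\ge 0$: $x_i\in\{1,2,3,4\}$; $(x_i,x_{i+1})\ne(4,4)$; and $(x_i,x_{i+1},x_{i+2},x_{i+3},x_{i+4})\ne(4,1,4,1,4)$. A Cantor-type set on a closed interval $I$ is a set $\mathcal{E}=I\setminus\bigcup_{k} U_k$, where $\{U_k\}_{k\ge 1}$ is a countable family of mutually disjoint open intervals (the gaps). $|A|=\sup A-\inf A$ denotes the length of an interval. Thickness: fix an order $U_1,U_2,\dots$ of the gaps. For each $k$, let $I_k$ be the largest closed interval contained in $\mathcal{E}_k=I\setminus\bigcup_{i=1}^{k-1}U_i$ that contains $U_k$, and let $I_k^1,I_k^2$ be the two maximal closed segments of $I_k\setminus U_k$ adjacent to $U_k$. The thickness $\tau(\mathcal{E})$ is said to be at least $\tau$ if $\tau\cdot|U_k|\le\min\{|I_k^1|,|I_k^2|\}$ for all $k$. Here $\tau(\mathcal{E})\ge\tau$ is understood to mean that this holds for some enumeration of the gaps, and $\tau(\mathcal{E})>1$ means that $\tau(\mathcal{E})\ge\tau$ for some real $\tau>1$. *)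

theory Defs
  imports "HOL-Analysis.Analysis" "HOL-Library.Extended_Nat"
begin

fun cf_convergent :: "(nat \<Rightarrow> int) \<Rightarrow> nat \<Rightarrow> real" where
  "cf_convergent a 0 = of_int (a 0)"
| "cf_convergent a (Suc n) = of_int (a 0) + 1 / cf_convergent (\<lambda>i. a (Suc i)) n"

definition regular_cf_expansion :: "(nat \<Rightarrow> int) \<Rightarrow> real \<Rightarrow> bool" where
  "regular_cf_expansion a x \<longleftrightarrow> (\<forall>i\<ge>1. a i \<ge> 1) \<and> cf_convergent a \<longlonglongrightarrow> x"

definition F4_star :: "real set" where
  "F4_star = {x. x \<notin> \<rat> \<and>
     (\<exists>a. regular_cf_expansion a x \<and> (a 0, a 1) = (4, 3) \<and>
        (\<forall>i. a i \<in> {1, 2, 3, 4} \<and>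
             (a i, a (i + 1)) \<noteq> (4, 4) \<and>
             (a i, a (i + 1), a (i + 2), a (i + 3), a (i + 4)) \<noteq> (4, 1, 4, 1, 4)))}"

definition closed_interval :: "real set \<Rightarrow> bool" where
  "closed_interval A \<longleftrightarrow> (\<exists>a b. a \<le> b \<and> A = {a..b})"

definition open_interval :: "real set \<Rightarrow> bool" where
  "open_interval A \<longleftrightarrow> (\<exists>a b. a < b \<and> A = {a<..<b})"

definition interval_length :: "real set \<Rightarrow> real" where
  "interval_length A = Sup A - Inf A"

text \<open>
  The gaps form a finite or infinite sequence \<open>U 0, U 1, \<dots>\<close>, of which only the terms
  \<open>U k\<close> with \<open>k < N\<close> are used; \<open>N = \<infinity>\<close> for infinitely many gaps.
  Since open gaps contained in \<open>I\<close> leave the endpoints of \<open>I\<close> in \<open>E\<close>, the interval \<open>I\<close> is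
  necessarily \<open>{Inf E..Sup E}\<close> and the gaps are the connected components of \<open>I - E\<close>, so that
  only the order of the gaps is a choice.
\<close>

definition cantor_type_set :: "real set \<Rightarrow> enat \<Rightarrow> (nat \<Rightarrow> real set) \<Rightarrow> real set \<Rightarrow> bool" where
  "cantor_type_set I N U E \<longleftrightarrow>
     closed_interval I \<and>
     (\<forall>k. enat k < N \<longrightarrow> open_interval (U k) \<and> U k \<subseteq> I) \<and>
     disjoint_family_on U {k. enat k < N} \<and>
     E = I - (\<Union>k\<in>{k. enat k < N}. U k)"

definition largest_closed_interval_around :: "real set \<Rightarrow> real set \<Rightarrow> real set \<Rightarrow> bool" where
  "largest_closed_interval_around V S J \<longleftrightarrow>
     closed_interval J \<and> V \<subseteq> J \<and> J \<subseteq> S \<and>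
     (\<forall>J'. closed_interval J' \<and> V \<subseteq> J' \<and> J' \<subseteq> S \<longrightarrow> J' \<subseteq> J)"

text \<open>
  For \<open>V = {a<..<b} \<subseteq> J = {c..d}\<close> the following two sets are \<open>{c..a}\<close> and \<open>{b..d}\<close>, the two
  components of \<open>J - V\<close>.
\<close>

definition left_segment :: "real set \<Rightarrow> real set \<Rightarrow> real set" where
  "left_segment J V = {x\<in>J. \<forall>v\<in>V. x < v}"

definition right_segment :: "real set \<Rightarrow> real set \<Rightarrow> real set" where
  "right_segment J V = {x\<in>J. \<forall>v\<in>V. v < x}"

definition thickness_at_least :: "real set \<Rightarrow> real \<Rightarrow> bool" where
  "thickness_at_least E \<tau> \<longleftrightarrow>
     (\<exists>I N U. cantor_type_set I N U E \<and>
        (\<forall>k. enat k < N \<longrightarrow>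
           (\<exists>J. largest_closed_interval_around (U k) (I - (\<Union>i<k. U i)) J \<and>
                \<tau> * interval_length (U k)
                  \<le> min (interval_length (left_segment J (U k)))
                        (interval_length (right_segment J (U k))))))"

end

(* The digit strings allowed in F4_star are recognised by an automaton with five states, so F4_star
   is the limit set of a tree of cylinders. Splitting off the smallest admissible first digit at each
   node makes this tree binary: a hull is divided into a gap and two bridges. Removing the gaps in
   order of increasing depth, the hull of a node is intact when its gap is removed, so it is enough
   that both bridges of every node exceed 1.002 times its gap. On a cylinder x = (p t + p')/(q t + q')
   the ratio of the right bridge [b, c] to the gap [a, b], in terms of the tail t, is
   (c - b)(a + r) / ((b - a)(c + r)) with r = q'/q. This is at least 1.0145 at every node; the
   tightest gap is that between the digits 3 and 4 after the block 41, where r >= 4/5. Since x stays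
   in [4.261, 4.312], the logarithm costs a factor of at most 4.312/4.261 < 1.0145/1.002. *)
theory Submission
  imports Defs
begin

section \<open>Thickness of the limit set of a binary tree of intervals\<close>

text \<open>Each digit composes with a decreasing map, so a bridge to the right of a gap in the tail
  t may lie on either side of it in x. Hence the estimates use absolute values, and the children of
  a node are labelled by the orientation of its cylinder. For a hull [e, c] with gap (a, b) in the
  tail, the left bridge has ratio (a - e)(b + r) / ((b - a)(e + r)). Its weight (b + r)/(e + r)
  exceeds 1, so comparing plain lengths suffices. For the right bridge the weight is below 1 and the
  past matters: after 41 the block 41414 pulls the greatest tail down from about 4.827 to about
  4.793, and with r = 0 the bridge of the digit 4 would be shorter than the gap before it. Thickness
  speaks of points that survive the gaps, \<open>F4_star\<close> of digit sequences. A coinductive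
  predicate on tails links the two. The hull endpoints are themselves values of admissible
  expansions, which is why open gaps fit.\<close>

lemma interval_length_cbox: "a \<le> b \<Longrightarrow> interval_length {a..b} = b - a"
  by (simp add: interval_length_def)

lemma interval_length_box: "a < b \<Longrightarrow> interval_length {a<..<b} = b - a"
  by (simp add: interval_length_def)

lemma closed_interval_cbox: "a \<le> b \<Longrightarrow> closed_interval {a..b}"
  unfolding closed_interval_def by blast

lemma open_interval_box: "a < b \<Longrightarrow> open_interval {a<..<b}"
  unfolding open_interval_def by blast

text \<open>The interval is the connected component of the midpoint of the gap: compact and
  connected, hence of the form {c..d}, and maximal among connected subsets of S.\<close>

lemma largest_closed_interval_around_exists:
  assumes "compact S" and "a < b" and "{a<..<b} \<subseteq> {l..r}" and "{l..r} \<subseteq> S"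
  obtains c d where "c \<le> l" "r \<le> d" "largest_closed_interval_around {a<..<b} S {c..d}"
proof -
  define x where "x = (a + b) / 2"
  have x: "x \<in> {a<..<b}"
    using \<open>a < b\<close> by (simp add: x_def)
  let ?J = "connected_component_set S x"
  have "compact ?J" "connected ?J"
    using \<open>compact S\<close> closed_connected_component[of S x]
    by (auto simp: compact_eq_bounded_closed intro: bounded_subset[OF _ connected_component_subset])
  then obtain c d where J: "?J = {c..d}"
    by (metis connected_compact_interval_1)
  have max: "J' \<subseteq> ?J" if "closed_interval J'" "{a<..<b} \<subseteq> J'" "J' \<subseteq> S" for J'
  proof (rule connected_component_maximal)
    show "x \<in> J'" using that x by blast
    show "connected J'" using that(1) by (auto simp: closed_interval_def)
  qed (fact that)
  have lr: "l \<le> r" using x assms(3) by fastforce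
  have "{l..r} \<subseteq> ?J"
    using assms lr by (intro max) (auto simp: closed_interval_def)
  with J lr have "c \<le> l" "r \<le> d" by auto
  moreover have "largest_closed_interval_around {a<..<b} S {c..d}"
    unfolding largest_closed_interval_around_def
  proof (intro conjI allI impI)
    show "closed_interval {c..d}"
      using lr calculation by (intro closed_interval_cbox) simp
    show "{a<..<b} \<subseteq> {c..d}" using assms(3) \<open>{l..r} \<subseteq> ?J\<close> J by blast
    show "{c..d} \<subseteq> S" using J connected_component_subset by metis
    show "J' \<subseteq> {c..d}" if "closed_interval J' \<and> {a<..<b} \<subseteq> J' \<and> J' \<subseteq> S" for J'
      using max[of J'] that J by simp
  qed
  ultimately show ?thesis using that by blast
qed

lemma left_segment_box:
  fixes a b :: real
  assumes "a < b" "b \<le> d"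
  shows "left_segment {c..d} {a<..<b} = {c..a}"
proof -
  have "x \<le> a" if "\<forall>v\<in>{a<..<b}. x < v" for x
  proof (rule ccontr)
    assume "\<not> x \<le> a"
    then obtain v where "a < v" "v < min x b" using assms dense[of a "min x b"] by auto
    with that have "v < x \<and> x < v" by auto
    then show False by linarith
  qed
  moreover have "\<forall>v\<in>{a<..<b}. x < v" if "x \<le> a" for x
    using that by simp
  ultimately have "(\<forall>v\<in>{a<..<b}. x < v) \<longleftrightarrow> x \<le> a" for x
    by blast
  then show ?thesis using assms by (simp only: left_segment_def) auto
qed

lemma right_segment_box:
  fixes a b :: real
  assumes "a < b" "c \<le> a"
  shows "right_segment {c..d} {a<..<b} = {b..d}"
proof -
  have "b \<le> x" if "\<forall>v\<in>{a<..<b}. v < x" for x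
  proof (rule ccontr)
    assume "\<not> b \<le> x"
    then obtain v where "max x a < v" "v < b" using assms dense[of "max x a" b] by auto
    with that have "v < x \<and> x < v" by auto
    then show False by linarith
  qed
  moreover have "\<forall>v\<in>{a<..<b}. v < x" if "b \<le> x" for x
    using that by simp
  ultimately have "(\<forall>v\<in>{a<..<b}. v < x) \<longleftrightarrow> b \<le> x" for x
    by blast
  then show ?thesis using assms by (simp only: right_segment_def) auto
qed

text \<open>The intervals I_k need not be computed. If earlier gaps miss {l k..r k}, then I_k
  contains this hull, so its two segments contain the bridges and are at least as long. The same
  condition makes the gaps disjoint.\<close>

lemma thickness_at_leastI:
  fixes a b l r :: "nat \<Rightarrow> real"
  assumes "lo \<le> hi" and "E = {lo..hi} - (\<Union>k. {a k<..<b k})"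
    and ord: "\<And>k. l k \<le> a k" "\<And>k. a k < b k" "\<And>k. b k \<le> r k"
    and sub: "\<And>k. {l k..r k} \<subseteq> {lo..hi}"
    and disj: "\<And>i k. i < k \<Longrightarrow> {a i<..<b i} \<inter> {l k..r k} = {}"
    and bridges: "\<And>k. \<tau> * (b k - a k) \<le> a k - l k" "\<And>k. \<tau> * (b k - a k) \<le> r k - b k"
  shows "thickness_at_least E \<tau>"
proof -
  let ?U = "\<lambda>k. {a k<..<b k}"
  have Usub: "?U k \<subseteq> {l k..r k}" for k
    using ord[of k] by (intro subsetI) auto
  have "?U i \<inter> ?U k = {}" if "i < k" for i k
    using Int_mono[OF subset_refl Usub[of k], of "?U i"] disj[OF that] by (metis subset_empty)
  then have disjU: "?U i \<inter> ?U k = {}" if "i \<noteq> k" for i k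
    using that by (metis Int_commute nat_neq_iff)
  then have "disjoint_family_on ?U {k. enat k < \<infinity>}"
    unfolding disjoint_family_on_def by (intro ballI impI) (rule disjU)
  moreover have "closed_interval {lo..hi}"
    using assms(1) by (rule closed_interval_cbox)
  moreover have "open_interval (?U k)" for k
    using ord(2)[of k] by (rule open_interval_box)
  moreover have "?U k \<subseteq> {lo..hi}" for k
    using Usub[of k] sub[of k] by (rule subset_trans)
  ultimately have "cantor_type_set {lo..hi} \<infinity> ?U E"
    using assms(2) by (simp add: cantor_type_set_def)
  moreover have "\<exists>J. largest_closed_interval_around (?U k) ({lo..hi} - (\<Union>i<k. ?U i)) J \<and>
       \<tau> * interval_length (?U k)
         \<le> min (interval_length (left_segment J (?U k))) (interval_length (right_segment J (?U k)))" for k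
  proof -
    have "compact ({lo..hi} - (\<Union>i<k. ?U i))"
      by (intro compact_diff compact_Icc open_UN ballI open_greaterThanLessThan)
    moreover have "{l k..r k} \<subseteq> {lo..hi} - (\<Union>i<k. ?U i)"
      using sub[of k] disj[of _ k] by fast
    ultimately obtain c d where cd: "c \<le> l k" "r k \<le> d"
      "largest_closed_interval_around (?U k) ({lo..hi} - (\<Union>i<k. ?U i)) {c..d}"
      using largest_closed_interval_around_exists[OF _ ord(2)[of k] Usub[of k]] by metis
    have "left_segment {c..d} (?U k) = {c..a k}" "right_segment {c..d} (?U k) = {b k..d}"
      using ord[of k] cd(1,2) by (intro left_segment_box right_segment_box; linarith)+
    then have "\<tau> * interval_length (?U k)
         \<le> min (interval_length (left_segment {c..d} (?U k))) (interval_length (right_segment {c..d} (?U k)))"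
      using cd(1,2) bridges[of k] ord[of k]
      by (simp add: interval_length_cbox interval_length_box)
    with cd(3) show ?thesis by blast
  qed
  ultimately show ?thesis
    unfolding thickness_at_least_def by blast
qed

text \<open>Bijective base-2 numeration: it enumerates all finite binary words by increasing length.\<close>

fun word_code :: "bool list \<Rightarrow> nat" where
  "word_code [] = 0"
| "word_code (b # p) = 2 * word_code p + (if b then 2 else 1)"

lemma word_code_bounds: "2 ^ length p \<le> word_code p + 1 \<and> word_code p + 1 < 2 ^ (length p + 1)"
  by (induction p) auto

text \<open>Words of length n have the codes from 2^n - 1 to 2^(n+1) - 2. Removing gaps in the order
  of codes thus never treats a node before a shallower one.\<close>

lemma word_code_mono: "word_code p \<le> word_code q \<Longrightarrow> length p \<le> length q"
proof (rule ccontr)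
  assume "word_code p \<le> word_code q" "\<not> length p \<le> length q"
  then have "(2::nat) ^ (length q + 1) \<le> 2 ^ length p"
    by (intro power_increasing) auto
  with word_code_bounds[of p] word_code_bounds[of q] \<open>word_code p \<le> word_code q\<close>
  show False by linarith
qed

lemma bij_word_code: "bij word_code"
proof (rule bijI)
  have "word_code p = word_code q \<Longrightarrow> p = q" for p q
  proof (induction p arbitrary: q)
    case Nil
    then show ?case by (cases q) (auto split: if_splits)
  next
    case (Cons b p)
    then obtain c q' where q: "q = c # q'" by (cases q) (auto split: if_splits)
    with Cons.prems have "word_code p = word_code q' \<and> b = c"
      by (auto split: if_splits) presburger+
    then show ?case using Cons.IH q by simp
  qed
  then show "inj word_code" by (auto intro: injI)
  have "\<exists>p. n = word_code p" for n
  proof (induction n rule: less_induct)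
    case (less n)
    show ?case
    proof (cases "n = 0")
      case True
      then show ?thesis by (intro exI[of _ "[]"]) simp
    next
      case False
      \<comment> \<open>A positive n is 2m + 1 or 2m + 2 with m = (n - 1) div 2; its parity tells
        the first letter.\<close>
      then obtain p where "(n - 1) div 2 = word_code p" using less[of "(n - 1) div 2"] by fastforce
      then show ?thesis
        using False by (intro exI[of _ "even n # p"]) (simp, presburger)
    qed
  qed
  then show "surj word_code" by (auto simp: surj_def)
qed

text \<open>\<open>False\<close> and \<open>True\<close> stand for left and right on the real line.
  Since the outer endpoints are inherited, passing to the children removes exactly one open interval
  from a hull.\<close>

locale bridge_tree =
  fixes V :: "'n set" and child :: "bool \<Rightarrow> 'n \<Rightarrow> 'n" and lo hi :: "'n \<Rightarrow> real" and \<tau> :: real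
  assumes child_closed: "v \<in> V \<Longrightarrow> child b v \<in> V"
    and \<tau>_nonneg: "0 \<le> \<tau>"
    and lo_child: "v \<in> V \<Longrightarrow> lo (child False v) = lo v"
    and hi_child: "v \<in> V \<Longrightarrow> hi (child True v) = hi v"
    and gap_nonempty: "v \<in> V \<Longrightarrow> hi (child False v) < lo (child True v)"
    and left_bridge: "v \<in> V \<Longrightarrow>
      \<tau> * (lo (child True v) - hi (child False v)) \<le> hi (child False v) - lo v"
    and right_bridge: "v \<in> V \<Longrightarrow>
      \<tau> * (lo (child True v) - hi (child False v)) \<le> hi v - lo (child True v)"
begin

fun descend :: "'n \<Rightarrow> bool list \<Rightarrow> 'n" where
  "descend v [] = v"
| "descend v (b # p) = descend (child b v) p"

definition gap :: "'n \<Rightarrow> real set" where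
  "gap v = {hi (child False v)<..<lo (child True v)}"

definition remainder :: "'n \<Rightarrow> real set" where
  "remainder v = {lo v..hi v} - (\<Union>p. gap (descend v p))"

lemma descend_closed: "v \<in> V \<Longrightarrow> descend v p \<in> V"
  by (induction p arbitrary: v) (auto simp: child_closed)

lemma child_bounds:
  assumes "v \<in> V"
  shows "lo v \<le> hi (child False v)" "lo (child True v) \<le> hi v"
proof -
  have "0 \<le> \<tau> * (lo (child True v) - hi (child False v))"
    using \<tau>_nonneg gap_nonempty[OF assms] by simp
  then show "lo v \<le> hi (child False v)" "lo (child True v) \<le> hi v"
    using left_bridge[OF assms] right_bridge[OF assms] by simp_all
qed

lemma lo_le_hi: "v \<in> V \<Longrightarrow> lo v \<le> hi v"
  using child_bounds[of v] gap_nonempty[of v] by linarith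

lemma child_hull: "v \<in> V \<Longrightarrow> {lo (child b v)..hi (child b v)} \<subseteq> {lo v..hi v}"
  using child_bounds[of v] gap_nonempty[of v] lo_child[of v] hi_child[of v] by (cases b) auto

lemma child_hulls_disjoint:
  "v \<in> V \<Longrightarrow> b \<noteq> c \<Longrightarrow> {lo (child b v)..hi (child b v)} \<inter> {lo (child c v)..hi (child c v)} = {}"
  using gap_nonempty[of v] by (cases b; cases c) auto

lemma descend_hull: "v \<in> V \<Longrightarrow> {lo (descend v p)..hi (descend v p)} \<subseteq> {lo v..hi v}"
proof (induction p arbitrary: v)
  case (Cons b p)
  then show ?case using child_hull[of v b] child_closed[of v b] by fastforce
qed simp

lemma gap_hull: "v \<in> V \<Longrightarrow> gap v \<subseteq> {lo v..hi v}"
  using child_bounds[of v] by (auto simp: gap_def)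

lemma gap_child: "gap v \<inter> {lo (child b v)..hi (child b v)} = {}"
  by (cases b) (auto simp: gap_def)

text \<open>Either q is a proper prefix of p, and the hull at p lies in a child of the node at q, or
  the words branch and the two sets lie in different children of the branching node. The length
  condition excludes that p is a proper prefix of q.\<close>

lemma gap_descend_hull_disjoint:
  assumes "v \<in> V" "length q \<le> length p" "q \<noteq> p"
  shows "gap (descend v q) \<inter> {lo (descend v p)..hi (descend v p)} = {}"
  using assms
proof (induction p arbitrary: v q)
  case (Cons b p)
  have cl: "child c v \<in> V" for c using Cons.prems child_closed by blast
  have sub: "{lo (descend v (b # p))..hi (descend v (b # p))} \<subseteq> {lo (child b v)..hi (child b v)}"
    using descend_hull[OF cl] by simp
  show ?case
  proof (cases q)
    case Nil
    then show ?thesis using sub gap_child[of v b] by auto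
  next
    case (Cons c q')
    show ?thesis
    proof (cases "b = c")
      case True
      then show ?thesis using Cons.IH[OF cl] Cons.prems Cons by simp
    next
      case False
      have "gap (descend v q) \<subseteq> {lo (child c v)..hi (child c v)}"
        using gap_hull[OF descend_closed[OF cl]] descend_hull[OF cl] Cons by fastforce
      then show ?thesis
        using sub child_hulls_disjoint[OF Cons.prems(1) False] by blast
    qed
  qed
qed simp

lemma thickness_remainder:
  assumes "v \<in> V"
  shows "thickness_at_least (remainder v) \<tau>"
proof -
  define n where "n k = descend v (inv word_code k)" for k
  have n: "n k \<in> V" for k
    using assms by (simp add: n_def descend_closed)
  show ?thesis
  proof (rule thickness_at_leastI)
    have "(\<Union>k. gap (n k)) = (\<Union>p. gap (descend v p))"
      unfolding n_def using bij_word_code by (metis (no_types) bij_imp_bij_inv bij_is_surj image_image)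
    then show "remainder v = {lo v..hi v} -
        (\<Union>k. {hi (child False (n k))<..<lo (child True (n k))})"
      by (simp add: remainder_def gap_def)
    show "{hi (child False (n i))<..<lo (child True (n i))} \<inter> {lo (n k)..hi (n k)} = {}"
      if "i < k" for i k
    proof -
      have "word_code (inv word_code j) = j" for j
        using bij_word_code by (simp add: bij_is_surj surj_f_inv_f)
      then have "length (inv word_code i) \<le> length (inv word_code k)" "inv word_code i \<noteq> inv word_code k"
        using that by (metis word_code_mono less_imp_le, metis less_irrefl)
      then show ?thesis
        using gap_descend_hull_disjoint[OF assms] by (simp add: n_def gap_def)
    qed
    show "{lo (n k)..hi (n k)} \<subseteq> {lo v..hi v}" for k
      unfolding n_def by (rule descend_hull[OF assms])
  qed (use assms n child_bounds lo_le_hi gap_nonempty left_bridge right_bridge \<tau>_nonneg in auto)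
qed

lemma remainder_child:
  assumes "v \<in> V" "x \<in> remainder v"
  obtains b where "x \<in> remainder (child b v)"
proof -
  have "x \<notin> gap (descend v (b # p))" for b p
    using assms(2) unfolding remainder_def by blast
  then have ng: "x \<notin> gap (descend (child b v) p)" for b p
    by simp
  have "x \<notin> gap (descend v [])"
    using assms(2) unfolding remainder_def by blast
  moreover have "lo v \<le> x" "x \<le> hi v"
    using assms(2) by (simp_all add: remainder_def)
  ultimately have "x \<in> {lo (child False v)..hi (child False v)} \<or> x \<in> {lo (child True v)..hi (child True v)}"
    using lo_child[OF assms(1)] hi_child[OF assms(1)] by (auto simp: gap_def)
  then show ?thesis
    using that ng by (auto simp: remainder_def)
qed

text \<open>\<open>Q\<close> follows the one path whose hulls contain x. A word that leaves this
  path ends in a hull disjoint from x; a word on it ends at a node with x in the hull of a child,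
  off the gap.\<close>

lemma remainder_coinduct:
  assumes "Q v x" and "v \<in> V"
    and step: "\<And>v. v \<in> V \<Longrightarrow> Q v x \<Longrightarrow> x \<in> {lo v..hi v} \<and> (\<exists>b. Q (child b v) x)"
  shows "x \<in> remainder v"
proof -
  have "x \<notin> gap (descend w p)" if "w \<in> V" "Q w x" for w p
    using that
  proof (induction p arbitrary: w)
    case Nil
    then show ?case
      using step child_closed gap_child[of w] by (metis IntI descend.simps(1) empty_iff)
  next
    case (Cons c p)
    then obtain b where b: "Q (child b w) x" using step by blast
    have cl: "child d w \<in> V" for d using Cons.prems child_closed by blast
    show ?case
    proof (cases "b = c")
      case True
      then show ?thesis using Cons.IH[OF cl] b by simp
    next
      case False
      have "x \<in> {lo (child b w)..hi (child b w)}" using step[OF cl b] by blast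
      moreover have "gap (descend w (c # p)) \<subseteq> {lo (child c w)..hi (child c w)}"
        using gap_hull[OF descend_closed[OF cl]] descend_hull[OF cl] by fastforce
      ultimately show ?thesis
        using child_hulls_disjoint[OF Cons.prems(1) False] by blast
    qed
  qed
  then show ?thesis using assms step[of v] by (auto simp: remainder_def)
qed

end

section \<open>The automaton of forbidden blocks and its extreme continued fractions\<close>

text \<open>A state records the longest suffix of the digits read so far that is a proper prefix of one
  of the forbidden blocks \<open>44\<close> and \<open>41414\<close>.\<close>

datatype state = S0 | S4 | S41 | S414 | S4141

definition step :: "state \<Rightarrow> int \<Rightarrow> state" where
  "step s d =
     (if d = 4 then (if s = S41 then S414 else S4)
      else if d = 1 then (case s of S4 \<Rightarrow> S41 | S414 \<Rightarrow> S4141 | _ \<Rightarrow> S0)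
      else S0)"

text \<open>Both forbidden blocks end in 4, so only the digit 4 is ever refused and the admissible
  digits form an initial segment. Values of \<open>step\<close> at refused digits are irrelevant
  fillers.\<close>

definition max_digit :: "state \<Rightarrow> int" where
  "max_digit s = (if s = S0 \<or> s = S41 then 4 else 3)"

text \<open>The largest continued fraction readable from \<open>S0\<close> is \<open>\<mu> = [4; 1, 4, 1, 3, 1, \<mu>]\<close>; the extreme
  values for the other states are obtained from it.\<close>

definition \<mu> :: real where "\<mu> = (117 + sqrt 26565) / 58"

definition least_tail :: "state \<Rightarrow> real" where
  "least_tail s = (case s of
     S4 \<Rightarrow> 1 + 1 / (4 + 1 / (1 + 1 / (3 + 1 / (1 + 1 / \<mu>))))
   | S414 \<Rightarrow> 1 + 1 / (3 + 1 / (1 + 1 / \<mu>))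
   | _ \<Rightarrow> 1 + 1 / \<mu>)"

definition greatest_tail :: "state \<Rightarrow> real" where
  "greatest_tail s = (case s of
     S0 \<Rightarrow> \<mu>
   | S41 \<Rightarrow> 4 + 1 / (1 + 1 / (3 + 1 / (1 + 1 / \<mu>)))
   | _ \<Rightarrow> 3 + 1 / (1 + 1 / \<mu>))"

lemma \<mu>_bounds: "4.82737 < \<mu>" "\<mu> < 4.82738"
proof -
  have "162.98746 < sqrt 26565" by (rule real_less_rsqrt) (simp add: power2_eq_square)
  moreover have "sqrt 26565 < 162.98804" by (rule real_less_lsqrt) (simp_all add: power2_eq_square)
  ultimately show "4.82737 < \<mu>" "\<mu> < 4.82738" unfolding \<mu>_def by simp_all
qed

text \<open>Extreme values alternate greatest and least digits, because inversion reverses order;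
  from \<open>S0\<close> the digits 4, 1, 4, 1, 3, 1 lead back to \<open>S0\<close>. Collapsing them
  gives a Moebius map whose fixed points solve 29 z^2 = 117 z + 111.\<close>

lemma \<mu>_fixpoint: "4 + 1 / (1 + 1 / (4 + 1 / (1 + 1 / (3 + 1 / (1 + 1 / \<mu>))))) = \<mu>"
proof -
  have "(58 * \<mu> - 117)\<^sup>2 = 26565" by (simp add: \<mu>_def field_simps)
  then have quad: "29 * (\<mu> * \<mu>) = 117 * \<mu> + 111"
    by (simp add: power2_eq_square algebra_simps)
  have pos: "\<mu> > 0" using \<mu>_bounds by simp
  have "4 + 1 / (1 + 1 / (4 + 1 / (1 + 1 / (3 + 1 / (1 + 1 / \<mu>))))) = (140 * \<mu> + 111) / (29 * \<mu> + 23)"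
    using pos by (simp add: field_simps)
  also have "\<dots> = \<mu>"
    using pos quad by (simp add: field_simps)
  finally show ?thesis .
qed

lemma inverse_enclosure:
  fixes x l u :: real
  assumes "l < x" "x < u" "0 < l" "l' * u \<le> 1" "1 \<le> u' * l"
  shows "l' < 1 / x \<and> 1 / x < u'"
proof -
  have "0 < x" using assms by simp
  have "1 / u < 1 / x" "1 / x < 1 / l"
    using assms \<open>0 < x\<close> by (simp_all add: frac_less2)
  moreover have "l' \<le> 1 / u" "1 / l \<le> u'"
    using assms by (simp_all add: field_simps)
  ultimately show ?thesis by linarith
qed

lemma least_tail_bounds:
  "1.20715 < least_tail S0" "least_tail S0 < 1.20716"
  "1.20864 < least_tail S4" "least_tail S4 < 1.20865"
  "1.2612 < least_tail S414" "least_tail S414 < 1.26121"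
  and greatest_tail_bounds:
  "4.82737 < greatest_tail S0" "greatest_tail S0 < 4.82738"
  "3.82838 < greatest_tail S4" "greatest_tail S4 < 3.8284"
  "4.79288 < greatest_tail S41" "greatest_tail S41 < 4.7929"
proof -
  \<comment> \<open>In order of nesting these are the least tail of \<open>S0\<close>, the greatest
    of \<open>S4\<close>, the least of \<open>S414\<close> and the greatest of \<open>S41\<close>;
    one further layer gives the least tail of \<open>S4\<close>. Each enclosure comes from the
    previous one.\<close>
  let ?a = "1 + 1 / \<mu>"
  let ?c = "3 + 1 / ?a"
  let ?d = "1 + 1 / ?c"
  let ?e = "4 + 1 / ?d"
  have a: "1.20715 < ?a \<and> ?a < 1.20716"
    using inverse_enclosure[of "4.82737" \<mu> "4.82738" "0.20715" "0.20716"] \<mu>_bounds by simp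
  then have c: "3.82838 < ?c \<and> ?c < 3.8284"
    using inverse_enclosure[of "1.20715" ?a "1.20716" "0.82838" "0.8284"] by simp
  then have d: "1.2612 < ?d \<and> ?d < 1.26121"
    using inverse_enclosure[of "3.82838" ?c "3.8284" "0.2612" "0.26121"] by simp
  then have e: "4.79288 < ?e \<and> ?e < 4.7929"
    using inverse_enclosure[of "1.2612" ?d "1.26121" "0.79288" "0.7929"] by simp
  then have f: "1.20864 < 1 + 1 / ?e \<and> 1 + 1 / ?e < 1.20865"
    using inverse_enclosure[of "4.79288" ?e "4.7929" "0.20864" "0.20865"] by simp
  show "1.20715 < least_tail S0" "least_tail S0 < 1.20716"
    "1.20864 < least_tail S4" "least_tail S4 < 1.20865"
    "1.2612 < least_tail S414" "least_tail S414 < 1.26121"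
    using a d f by (simp_all only: least_tail_def state.case)
  show "4.82737 < greatest_tail S0" "greatest_tail S0 < 4.82738"
    "3.82838 < greatest_tail S4" "greatest_tail S4 < 3.8284"
    "4.79288 < greatest_tail S41" "greatest_tail S41 < 4.7929"
    using \<mu>_bounds c e by (simp_all only: greatest_tail_def state.case)
qed

lemma tail_eqs:
  "least_tail S41 = least_tail S0" "least_tail S4141 = least_tail S0"
  "greatest_tail S414 = greatest_tail S4" "greatest_tail S4141 = greatest_tail S4"
  by (simp_all add: least_tail_def greatest_tail_def)

lemma inverse_least_tail_bounds:
  "0.82838 < 1 / least_tail S0" "1 / least_tail S0 < 0.8284"
  "0.82736 < 1 / least_tail S4" "1 / least_tail S4 < 0.82738"
  "0.79288 < 1 / least_tail S414" "1 / least_tail S414 < 0.7929"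
  using inverse_enclosure[of "1.20715" "least_tail S0" "1.20716" "0.82838" "0.8284"]
    inverse_enclosure[of "1.20864" "least_tail S4" "1.20865" "0.82736" "0.82738"]
    inverse_enclosure[of "1.2612" "least_tail S414" "1.26121" "0.79288" "0.7929"]
    least_tail_bounds by simp_all

lemma inverse_greatest_tail_bounds:
  "0.20715 < 1 / greatest_tail S0" "1 / greatest_tail S0 < 0.20716"
  "0.2612 < 1 / greatest_tail S4" "1 / greatest_tail S4 < 0.26121"
  "0.20864 < 1 / greatest_tail S41" "1 / greatest_tail S41 < 0.20865"
  using inverse_enclosure[of "4.82737" "greatest_tail S0" "4.82738" "0.20715" "0.20716"]
    inverse_enclosure[of "3.82838" "greatest_tail S4" "3.8284" "0.2612" "0.26121"]
    inverse_enclosure[of "4.79288" "greatest_tail S41" "4.7929" "0.20864" "0.20865"]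
    greatest_tail_bounds by simp_all

lemmas tail_numerics = least_tail_bounds greatest_tail_bounds
  inverse_least_tail_bounds inverse_greatest_tail_bounds

lemma least_tail_gt: "1.2 < least_tail s"
  using tail_numerics by (cases s) (simp_all add: tail_eqs)

lemma greatest_tail_gt: "3.8 < greatest_tail s"
  using tail_numerics by (cases s) (simp_all add: tail_eqs)

lemma least_tail_lt: "least_tail s < 1.3"
  using tail_numerics by (cases s) (simp_all add: tail_eqs)

lemma inverse_tail_bounds:
  "0.79288 < 1 / least_tail s" "1 / least_tail s < 0.8284"
  "0.20715 < 1 / greatest_tail s" "1 / greatest_tail s < 0.26121"
  using inverse_least_tail_bounds inverse_greatest_tail_bounds
  by (cases s; simp add: tail_eqs)+

section \<open>Hulls of single digits and the gaps between them\<close>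

definition digit_lo :: "state \<Rightarrow> int \<Rightarrow> real" where
  "digit_lo s d = d + 1 / greatest_tail (step s d)"

definition digit_hi :: "state \<Rightarrow> int \<Rightarrow> real" where
  "digit_hi s d = d + 1 / least_tail (step s d)"

text \<open>This equation and its counterpart for the greatest digit say that the first and last
  digit hulls reach the ends of the hull of the state; they make the hulls of consecutive tree
  levels fit together.\<close>

lemma digit_lo_1: "digit_lo s 1 = least_tail s"
  by (cases s) (simp_all add: digit_lo_def step_def least_tail_def greatest_tail_def)

lemma digit_hi_max: "digit_hi s (max_digit s) = greatest_tail s"
  using \<mu>_fixpoint
  by (cases s) (simp_all add: digit_hi_def step_def max_digit_def least_tail_def greatest_tail_def)

lemma digit_bounds:
  assumes "1 \<le> d" "d \<le> max_digit s"
  shows "least_tail s \<le> digit_lo s d" "digit_lo s d < digit_hi s d" "digit_hi s d \<le> greatest_tail s"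
proof -
  have "1 / greatest_tail t < 1 / least_tail t" for t
    using least_tail_gt[of t] least_tail_lt[of t] greatest_tail_gt[of t] by (simp add: frac_less2)
  then show "digit_lo s d < digit_hi s d" by (simp add: digit_lo_def digit_hi_def)
  have "0 < 1 / greatest_tail t" for t
    using greatest_tail_gt[of t] by simp
  then have "2 \<le> d \<Longrightarrow> 2 < digit_lo s d"
    using of_int_le_iff[of 2 d, where ?'a = real]
    by (metis add_mono_thms_linordered_field(4) add.right_neutral digit_lo_def of_int_numeral)
  then show "least_tail s \<le> digit_lo s d"
    using assms least_tail_lt[of s] digit_lo_1[of s] by (cases "d = 1") auto
  have "1 / least_tail t < 1" for t
    using least_tail_gt[of t] by simp
  then have "digit_hi s d < d + 1" by (simp add: digit_hi_def)
  moreover have "d < max_digit s \<Longrightarrow> d + 1 \<le> real_of_int (max_digit s)"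
    by linarith
  moreover have "real_of_int (max_digit s) < greatest_tail s"
    using digit_hi_max[of s] least_tail_gt[of "step s (max_digit s)"]
    by (simp add: digit_hi_def flip: digit_hi_max)
  ultimately show "digit_hi s d \<le> greatest_tail s"
    using assms digit_hi_max[of s] by (cases "d = max_digit s") auto
qed

text \<open>\<open>r\<close> is the ratio of two consecutive convergent denominators; the gap between the digits
  3 and 4 after \<open>41\<close> is the only one for which \<open>r \<ge> 0\<close> does not suffice.\<close>

lemma digit_gap:
  fixes r :: real
  assumes "1 \<le> j" "j < max_digit s" "0 \<le> r" "s = S41 \<Longrightarrow> 0.8 \<le> r"
  shows "digit_hi s j < digit_lo s (j + 1)"
    and "1.0145 * (digit_lo s (j + 1) - digit_hi s j) \<le> digit_hi s j - digit_lo s j"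
    and "1.0145 * (digit_lo s (j + 1) - digit_hi s j) * (greatest_tail s + r)
      \<le> (greatest_tail s - digit_lo s (j + 1)) * (digit_hi s j + r)"
proof -
  let ?a = "digit_hi s j" and ?b = "digit_lo s (j + 1)" and ?\<beta> = "greatest_tail s"
  \<comment> \<open>The right side minus the left is bounded below by an affine function of r with
    slope h - 1.0145 g, which is nonnegative; so the numerical check is only made at the smallest
    value r0.\<close>
  have aux: "1.0145 * (?b - ?a) * (?\<beta> + r) \<le> (?\<beta> - ?b) * (?a + r)"
    if "?b - ?a \<le> g" "0 \<le> g" "h \<le> ?\<beta> - ?b" "0 \<le> h" "v \<le> ?a" "0 \<le> v"
      "1.0145 * g \<le> h" "r0 \<le> r" "1.0145 * g * (?\<beta> + r0) \<le> h * (v + r0)" for g h v r0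
  proof -
    have "1.0145 * (?b - ?a) * (?\<beta> + r) \<le> 1.0145 * g * (?\<beta> + r)"
      using that(1) \<open>0 \<le> r\<close> greatest_tail_gt[of s] by (intro mult_right_mono) simp_all
    also have "\<dots> = 1.0145 * g * (?\<beta> + r0) + 1.0145 * g * (r - r0)"
      by (simp only: ring_distribs)
    also have "\<dots> \<le> h * (v + r0) + h * (r - r0)"
      using that(7,8,9) by (intro add_mono mult_right_mono) simp_all
    also have "\<dots> = h * (v + r)" by (simp add: algebra_simps)
    also have "\<dots> \<le> (?\<beta> - ?b) * (?a + r)"
      using that(3,4,5,6) \<open>0 \<le> r\<close> by (intro mult_mono) simp_all
    finally show ?thesis .
  qed
  note inv = inverse_tail_bounds
  have \<beta>: "3.82838 < ?\<beta>"
    using greatest_tail_bounds by (cases s) (simp_all add: tail_eqs)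
  have "?a < ?b \<and> 1.0145 * (?b - ?a) \<le> ?a - digit_lo s j \<and>
    1.0145 * (?b - ?a) * (?\<beta> + r) \<le> (?\<beta> - ?b) * (?a + r)"
  proof (cases "j < 3")
    case True
    then consider "j = 1" | "j = 2" using assms by linarith
    then show ?thesis
    proof cases
      case 1
      have "1.79288 < ?a" "?a < 1.8284" "digit_lo s j < 1.26121"
        using inv(1,2,4)[of "step s 1"] unfolding digit_hi_def digit_lo_def 1 by simp_all
      moreover have "2.20715 < ?b" "?b < 2.20716"
        using inverse_greatest_tail_bounds(1,2) by (simp_all add: digit_lo_def 1 step_def)
      ultimately show ?thesis
        using \<beta> \<open>0 \<le> r\<close> by (intro conjI aux[of "0.41428" "?\<beta> - ?b" "1.79288" 0]) simp_all
    next
      case 2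
      have "2.82838 < ?a" "?a < 2.8284" "digit_lo s j < 2.20716" "3.20715 < ?b" "?b < 3.20716"
        using inverse_least_tail_bounds(1,2) inverse_greatest_tail_bounds(1,2)
        by (simp_all add: digit_hi_def digit_lo_def 2 step_def)
      then show ?thesis
        using \<beta> \<open>0 \<le> r\<close> by (intro conjI aux[of "0.37878" "?\<beta> - ?b" "2.82838" 0]) simp_all
    qed
  next
    case False
    then have j: "j = 3" and s: "s = S0 \<or> s = S41"
      using assms by (auto simp: max_digit_def split: if_splits)
    have ab: "3.82838 < ?a" "?a < 3.8284" "digit_lo s j < 3.20716"
      using inverse_least_tail_bounds(1,2) inverse_greatest_tail_bounds(1,2)
      by (simp_all add: digit_hi_def digit_lo_def j step_def)
    have b: "4.2612 < ?b" "?b < 4.26121"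
      using inverse_greatest_tail_bounds(3,4) s
      by (auto simp: digit_lo_def j step_def tail_eqs)
    show ?thesis
    proof (cases "s = S0")
      case True
      then have "4.82737 < ?\<beta>" "?\<beta> < 4.82738" using greatest_tail_bounds(1,2) by simp_all
      then show ?thesis
        using ab b \<open>0 \<le> r\<close> by (intro conjI aux[of "0.43283" "0.56616" "3.82838" 0]) simp_all
    next
      case False
      then have "4.79288 < ?\<beta>" "?\<beta> < 4.7929" "0.8 \<le> r"
        using greatest_tail_bounds(5,6) s assms(4) by simp_all
      then show ?thesis
        using ab b by (intro conjI aux[of "0.43283" "0.53167" "3.82838" "0.8"]) simp_all
    qed
  qed
  then show "?a < ?b" "1.0145 * (?b - ?a) \<le> ?a - digit_lo s j"
    "1.0145 * (?b - ?a) * (?\<beta> + r) \<le> (?\<beta> - ?b) * (?a + r)"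
    by simp_all
qed

section \<open>Logarithmic cylinders\<close>

text \<open>The slope of \<open>ln\<close> on [l, u] lies between 1/u and 1/l. Absolute values make
  the bounds usable for cylinders of either orientation.\<close>

lemma abs_ln_diff_bounds:
  fixes x y :: real
  assumes "0 < l" "x \<in> {l..u}" "y \<in> {l..u}"
  shows "\<bar>ln x - ln y\<bar> \<le> \<bar>x - y\<bar> / l" "\<bar>x - y\<bar> / u \<le> \<bar>ln x - ln y\<bar>"
proof -
  have *: "ln x - ln y \<le> (x - y) / l \<and> (x - y) / u \<le> ln x - ln y"
    if "y \<le> x" "x \<in> {l..u}" "y \<in> {l..u}" for x y
  proof
    have pos: "0 < x" "0 < y" using that \<open>0 < l\<close> by auto
    have "ln x - ln y \<le> (x - y) / y"
      using pos ln_diff_le by simp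
    also have "\<dots> \<le> (x - y) / l"
      using that \<open>0 < l\<close> by (intro divide_left_mono) auto
    finally show "ln x - ln y \<le> (x - y) / l" .
    have "(x - y) / u \<le> (x - y) / x"
      using that pos by (intro divide_left_mono) auto
    also have "\<dots> = - ((y - x) / x)" by (simp add: diff_divide_distrib)
    also have "\<dots> \<le> ln x - ln y"
      using ln_diff_le[of y x] pos by linarith
    finally show "(x - y) / u \<le> ln x - ln y" .
  qed
  have u: "0 < u" using assms by auto
  consider "y \<le> x" | "x \<le> y" by linarith
  then have "\<bar>ln x - ln y\<bar> \<le> \<bar>x - y\<bar> / l \<and> \<bar>x - y\<bar> / u \<le> \<bar>ln x - ln y\<bar>"
  proof cases
    case 1
    then have "ln y \<le> ln x" using assms by auto
    then show ?thesis using * 1 assms by simp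
  next
    case 2
    then have "ln x \<le> ln y" using assms by auto
    then show ?thesis using *[OF 2] 2 assms by simp
  qed
  then show "\<bar>ln x - ln y\<bar> \<le> \<bar>x - y\<bar> / l" "\<bar>x - y\<bar> / u \<le> \<bar>ln x - ln y\<bar>"
    by simp_all
qed

abbreviation tail_hull :: "state \<Rightarrow> real set" where
  "tail_hull s \<equiv> {least_tail s..greatest_tail s}"

text \<open>\<open>\<phi> t\<close> is the logarithm of the continued fraction with a fixed prefix and tail \<open>t\<close>;
  \<open>q\<close> and \<open>q'\<close> are the last two convergent denominators.\<close>

definition log_cylinder :: "state \<Rightarrow> (real \<Rightarrow> real) \<Rightarrow> bool" where
  "log_cylinder s \<phi> \<longleftrightarrow> (\<exists>p p' q q'. 0 < q \<and> 0 \<le> q' \<and> p * q' \<noteq> p' * q \<and>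
     (s = S4 \<longrightarrow> 4 * q' \<le> q) \<and> (s = S41 \<longrightarrow> 4 * q \<le> 5 * q') \<and>
     (\<forall>t\<in>tail_hull s. \<phi> t = ln ((p * t + p') / (q * t + q')) \<and>
        4.261 \<le> (p * t + p') / (q * t + q') \<and> (p * t + p') / (q * t + q') \<le> 4.312))"

lemma log_cylinder_root: "log_cylinder S0 (\<lambda>t. ln (4 + 1 / (3 + 1 / t)))"
  unfolding log_cylinder_def
proof (intro exI conjI ballI)
  fix t assume "t \<in> tail_hull S0"
  then have t: "1.2071 < t" "t < 4.83" using least_tail_bounds greatest_tail_bounds by auto
  \<comment> \<open>The last two convergents of [4; 3] are 4/1 and 13/3.\<close>
  then show "ln (4 + 1 / (3 + 1 / t)) = ln ((13 * t + 4) / (3 * t + 1))"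
    by (intro arg_cong[where f = ln]) (simp add: field_simps)
  show "4.261 \<le> (13 * t + 4) / (3 * t + 1)" "(13 * t + 4) / (3 * t + 1) \<le> 4.312"
    using t by (simp_all add: field_simps)
qed simp_all

lemma one_div_tail:
  assumes "t \<in> tail_hull (step s d)"
  shows "d + 1 / t \<in> {digit_lo s d..digit_hi s d}"
  using assms least_tail_gt[of "step s d"] by (auto simp: digit_lo_def digit_hi_def frac_le)

text \<open>Substituting d + 1/t is the usual recurrence for numerators and denominators; the
  determinant only changes sign.\<close>

lemma log_cylinder_step:
  assumes "log_cylinder s \<phi>" "1 \<le> d" "d \<le> max_digit s"
  shows "log_cylinder (step s d) (\<lambda>t. \<phi> (d + 1 / t))"
proof -
  obtain p p' q q' where pq: "0 < q" "0 \<le> q'" "p * q' \<noteq> p' * q"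
    "s = S4 \<Longrightarrow> 4 * q' \<le> q" "s = S41 \<Longrightarrow> 4 * q \<le> 5 * q'"
    and \<phi>: "\<And>t. t \<in> tail_hull s \<Longrightarrow> \<phi> t = ln ((p * t + p') / (q * t + q')) \<and>
      4.261 \<le> (p * t + p') / (q * t + q') \<and> (p * t + p') / (q * t + q') \<le> 4.312"
    using assms(1) unfolding log_cylinder_def by blast
  have d: "1 \<le> real_of_int d" using assms by simp
  show ?thesis
    unfolding log_cylinder_def
  proof (rule exI[of _ "p * d + p'"], rule exI[of _ p], rule exI[of _ "q * d + q'"], rule exI[of _ q],
      intro conjI impI ballI)
    show "0 < q * d + q'" using pq d by (simp add: add_pos_nonneg)
    show "0 \<le> q" using pq by simp
    show "(p * d + p') * q \<noteq> p * (q * d + q')" using pq by (simp add: algebra_simps)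
    show "4 * q \<le> q * d + q'" if "step s d = S4"
      using that pq by (simp add: step_def split: if_splits state.splits)
    \<comment> \<open>\<open>S41\<close> is entered only from \<open>S4\<close> by the digit 1.
      There q' is at most q/4, so the new denominator q + q' is at most 5q/4; this is the source of
      r >= 4/5.\<close>
    show "4 * (q * d + q') \<le> 5 * q" if "step s d = S41"
      using that pq by (simp add: step_def split: if_splits state.splits)
    fix t assume t: "t \<in> tail_hull (step s d)"
    then have "0 < t" using least_tail_gt[of "step s d"] by auto
    then have "p * (d + 1 / t) + p' = ((p * d + p') * t + p) / t"
      "q * (d + 1 / t) + q' = ((q * d + q') * t + q) / t"
      by (simp_all add: field_simps)
    then have "(p * (d + 1 / t) + p') / (q * (d + 1 / t) + q') =
        ((p * d + p') * t + p) / ((q * d + q') * t + q)"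
      using \<open>0 < t\<close> by simp
    moreover have "d + 1 / t \<in> tail_hull s"
      using one_div_tail[OF t] digit_bounds[OF assms(2,3)] by auto
    ultimately show "\<phi> (d + 1 / t) = ln (((p * d + p') * t + p) / ((q * d + q') * t + q))"
      "4.261 \<le> ((p * d + p') * t + p) / ((q * d + q') * t + q)"
      "((p * d + p') * t + p) / ((q * d + q') * t + q) \<le> 4.312"
      using \<phi>[of "d + 1 / t"] by simp_all
  qed
qed

lemma moebius_diff:
  fixes p p' q q' x y :: real
  assumes "q * x + q' \<noteq> 0" "q * y + q' \<noteq> 0"
  shows "(p * x + p') / (q * x + q') - (p * y + p') / (q * y + q') =
    (p * q' - p' * q) * (x - y) / ((q * x + q') * (q * y + q'))"
  using assms by (simp add: diff_frac_eq algebra_simps)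

text \<open>The sign of the determinant \<open>p * q' - p' * q\<close> decides; it alternates with
  the length of the prefix, so both cases occur.\<close>

lemma log_cylinder_mono:
  assumes "log_cylinder s \<phi>"
  shows "(\<forall>x\<in>tail_hull s. \<forall>y\<in>tail_hull s. x < y \<longrightarrow> \<phi> x < \<phi> y) \<or>
    (\<forall>x\<in>tail_hull s. \<forall>y\<in>tail_hull s. x < y \<longrightarrow> \<phi> y < \<phi> x)"
proof -
  obtain p p' q q' where pq: "0 < q" "0 \<le> q'" "p * q' \<noteq> p' * q"
    and \<phi>: "\<And>t. t \<in> tail_hull s \<Longrightarrow> \<phi> t = ln ((p * t + p') / (q * t + q')) \<and>
      4.261 \<le> (p * t + p') / (q * t + q')"
    using assms(1) unfolding log_cylinder_def by blast
  have den: "0 < q * x + q'" if "x \<in> tail_hull s" for x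
    using that pq least_tail_gt[of s] by (intro add_pos_nonneg) auto
  have lt: "\<phi> x < \<phi> y \<longleftrightarrow> 0 < (p * q' - p' * q) * (y - x)"
    if "x \<in> tail_hull s" "y \<in> tail_hull s" for x y
  proof -
    have "\<phi> x < \<phi> y \<longleftrightarrow> 0 < (p * y + p') / (q * y + q') - (p * x + p') / (q * x + q')"
    proof -
      have "0 < c" if "4.261 \<le> c" for c :: real
        using that by (intro less_le_trans[of 0 "4.261" c]) simp_all
      then have "0 < (p * x + p') / (q * x + q')" "0 < (p * y + p') / (q * y + q')"
        using \<phi>[OF that(1), THEN conjunct2] \<phi>[OF that(2), THEN conjunct2]
        by blast+
      then show ?thesis
        using \<phi>[OF that(1)] \<phi>[OF that(2)] ln_less_cancel_iff by simp
    qed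
    also have "\<dots> \<longleftrightarrow> 0 < (p * q' - p' * q) * (y - x)"
    proof -
      have "0 < (q * y + q') * (q * x + q')" using den that by simp
      then have "0 < c / ((q * y + q') * (q * x + q')) \<longleftrightarrow> 0 < c" for c
        by (meson less_asym zero_less_divide_iff)
      then show ?thesis
        using den[OF that(1)] den[OF that(2)] by (subst moebius_diff) simp_all
    qed
    finally show ?thesis .
  qed
  define D where "D = p * q' - p' * q"
  note lt = lt[folded D_def]
  have "D \<noteq> 0" using pq by (simp add: D_def)
  then consider "0 < D" | "D < 0" by linarith
  then show ?thesis
  proof cases
    case 1
    then show ?thesis using lt by (intro disjI1) (simp add: mult_pos_pos)
  next
    case 2
    then show ?thesis using lt by (intro disjI2) (simp add: mult_neg_neg)
  qed
qed

text \<open>In the quotient of two image lengths sharing the endpoint y, the determinant and the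
  factor \<open>q * y + q'\<close> cancel; what remains is weighted by x + r and z + r. The order of
  x, y, z is left open so that the lemma serves both bridges.\<close>

lemma log_cylinder_ratio:
  assumes "log_cylinder s \<phi>"
  obtains r where "0 \<le> r" "s = S41 \<Longrightarrow> 0.8 \<le> r"
    "\<And>x y z. x \<in> tail_hull s \<Longrightarrow> y \<in> tail_hull s \<Longrightarrow> z \<in> tail_hull s \<Longrightarrow>
      1.0145 * \<bar>y - x\<bar> * (z + r) \<le> \<bar>z - y\<bar> * (x + r) \<Longrightarrow>
      1.002 * \<bar>\<phi> y - \<phi> x\<bar> \<le> \<bar>\<phi> z - \<phi> y\<bar>"
proof -
  obtain p p' q q' where pq: "0 < q" "0 \<le> q'" "p * q' \<noteq> p' * q" "s = S41 \<Longrightarrow> 4 * q \<le> 5 * q'"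
    and \<phi>: "\<And>t. t \<in> tail_hull s \<Longrightarrow> \<phi> t = ln ((p * t + p') / (q * t + q')) \<and>
      4.261 \<le> (p * t + p') / (q * t + q') \<and> (p * t + p') / (q * t + q') \<le> 4.312"
    using assms(1) unfolding log_cylinder_def by blast
  define D where "D = \<bar>p * q' - p' * q\<bar>"
  define M where "M t = (p * t + p') / (q * t + q')" for t
  have den: "0 < q * x + q'" if "x \<in> tail_hull s" for x
    using that pq least_tail_gt[of s] by (intro add_pos_nonneg) auto
  have M_diff: "\<bar>M x - M y\<bar> = D * \<bar>x - y\<bar> / ((q * x + q') * (q * y + q'))"
    if "x \<in> tail_hull s" "y \<in> tail_hull s" for x y
    using den[OF that(1)] den[OF that(2)]
    by (simp add: M_def D_def moebius_diff abs_mult)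
  have "1.002 * \<bar>\<phi> y - \<phi> x\<bar> \<le> \<bar>\<phi> z - \<phi> y\<bar>"
    if hull: "x \<in> tail_hull s" "y \<in> tail_hull s" "z \<in> tail_hull s"
      and ratio: "1.0145 * \<bar>y - x\<bar> * (z + q' / q) \<le> \<bar>z - y\<bar> * (x + q' / q)" for x y z
  proof -
    let ?X = "q * x + q'" and ?Y = "q * y + q'" and ?Z = "q * z + q'"
    note pos = hull[THEN den]
    have "q * (1.0145 * \<bar>y - x\<bar> * (z + q' / q)) \<le> q * (\<bar>z - y\<bar> * (x + q' / q))"
      using ratio pq by (intro mult_left_mono) simp_all
    then have ratio': "1.0145 * \<bar>y - x\<bar> * ?Z \<le> \<bar>z - y\<bar> * ?X"
      using pq by (simp add: algebra_simps)
    have cancel: "c * (D * w / (Y * X)) = D * (c * w * Z) / (X * Y * Z)"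
      "D * (w * X) / (X * Y * Z) = D * w / (Z * Y)"
      if "X \<noteq> 0" "Y \<noteq> 0" "Z \<noteq> 0" for c w X Y Z
      using that by (simp_all add: field_simps)
    have "1.0145 * \<bar>M y - M x\<bar> = D * (1.0145 * \<bar>y - x\<bar> * ?Z) / (?X * ?Y * ?Z)"
      unfolding M_diff[OF hull(2,1)] by (rule cancel(1)) (use pos in simp_all)
    also have "\<dots> \<le> D * (\<bar>z - y\<bar> * ?X) / (?X * ?Y * ?Z)"
      using ratio' pos by (intro divide_right_mono mult_left_mono) (simp_all add: D_def)
    also have "\<dots> = \<bar>M z - M y\<bar>"
      unfolding M_diff[OF hull(3,2)] by (rule cancel(2)) (use pos in simp_all)
    finally have M_ratio: "1.0145 * \<bar>M y - M x\<bar> \<le> \<bar>M z - M y\<bar>" .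
    have "\<bar>\<phi> y - \<phi> x\<bar> \<le> \<bar>M y - M x\<bar> / 4.261"
      using abs_ln_diff_bounds(1)[of "4.261" "M y" "4.312" "M x"] \<phi> hull by (simp add: M_def)
    moreover have "\<bar>M z - M y\<bar> / 4.312 \<le> \<bar>\<phi> z - \<phi> y\<bar>"
      using abs_ln_diff_bounds(2)[of "4.261" "M z" "4.312" "M y"] \<phi> hull by (simp add: M_def)
    moreover have "1.002 * A \<le> D'" if "A \<le> B / 4.261" "C / 4.312 \<le> D'" "1.0145 * B \<le> C" "0 \<le> D'"
      for A B C D' :: real
      using that by simp
    ultimately show ?thesis
      using M_ratio by (meson abs_ge_zero)
  qed
  moreover have "0 \<le> q' / q" "s = S41 \<Longrightarrow> 0.8 \<le> q' / q"
    using pq by (simp_all add: field_simps)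
  ultimately show ?thesis using that by blast
qed

text \<open>The node \<open>(\<phi>, s, j)\<close> stands for the tails read from \<open>s\<close> whose first digit is at least \<open>j\<close>:
  splitting off the digits one at a time, smallest first, makes the tree of cylinders binary.\<close>

type_synonym node = "(real \<Rightarrow> real) \<times> state \<times> int"

fun node_lo :: "node \<Rightarrow> real" where
  "node_lo (\<phi>, s, j) = min (\<phi> (digit_lo s j)) (\<phi> (greatest_tail s))"

fun node_hi :: "node \<Rightarrow> real" where
  "node_hi (\<phi>, s, j) = max (\<phi> (digit_lo s j)) (\<phi> (greatest_tail s))"

definition digit_node :: "(real \<Rightarrow> real) \<Rightarrow> state \<Rightarrow> int \<Rightarrow> node" where
  "digit_node \<phi> s d = (\<lambda>t. \<phi> (d + 1 / t), step s d, 1)"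

text \<open>A node with a single remaining digit would have no gap, so the last digit is passed on
  at once as the node of its own cylinder.\<close>

fun refine :: "bool \<Rightarrow> node \<Rightarrow> node" where
  "refine False (\<phi>, s, j) = digit_node \<phi> s j"
| "refine True (\<phi>, s, j) =
     (if j + 1 < max_digit s then (\<phi>, s, j + 1) else digit_node \<phi> s (j + 1))"

fun increasing :: "node \<Rightarrow> bool" where
  "increasing (\<phi>, s, j) \<longleftrightarrow> \<phi> (least_tail s) < \<phi> (greatest_tail s)"

text \<open>\<open>refine False\<close> takes the lower end in the tail, which is the right-hand end
  on the line when \<phi> decreases; comparing with \<open>increasing v\<close> corrects the
  side.\<close>

definition node_child :: "bool \<Rightarrow> node \<Rightarrow> node" where
  "node_child b v = refine (b = increasing v) v"

definition nodes :: "node set" where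
  "nodes = {(\<phi>, s, j). log_cylinder s \<phi> \<and> 1 \<le> j \<and> j < max_digit s}"

lemma digit_node_in_nodes:
  "log_cylinder s \<phi> \<Longrightarrow> 1 \<le> d \<Longrightarrow> d \<le> max_digit s \<Longrightarrow> digit_node \<phi> s d \<in> nodes"
  by (simp add: nodes_def digit_node_def log_cylinder_step max_digit_def)

lemma refine_in_nodes:
  assumes "log_cylinder s \<phi>" "1 \<le> j" "j < max_digit s"
  shows "refine c (\<phi>, s, j) \<in> nodes"
  using assms digit_node_in_nodes[of s \<phi> j] digit_node_in_nodes[of s \<phi> "j + 1"]
  by (cases c) (simp_all add: nodes_def)

lemma digit_node_bounds:
  "node_lo (digit_node \<phi> s d) = min (\<phi> (digit_lo s d)) (\<phi> (digit_hi s d))"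
  "node_hi (digit_node \<phi> s d) = max (\<phi> (digit_lo s d)) (\<phi> (digit_hi s d))"
  by (simp_all add: digit_node_def digit_lo_1) (simp_all add: digit_lo_def digit_hi_def min.commute max.commute)

lemma refine_True_bounds:
  assumes "j < max_digit s"
  shows "node_lo (refine True (\<phi>, s, j)) = min (\<phi> (digit_lo s (j + 1))) (\<phi> (greatest_tail s))"
    "node_hi (refine True (\<phi>, s, j)) = max (\<phi> (digit_lo s (j + 1))) (\<phi> (greatest_tail s))"
proof -
  have "j + 1 < max_digit s \<or> j + 1 = max_digit s" using assms by linarith
  then show "node_lo (refine True (\<phi>, s, j)) = min (\<phi> (digit_lo s (j + 1))) (\<phi> (greatest_tail s))"
    "node_hi (refine True (\<phi>, s, j)) = max (\<phi> (digit_lo s (j + 1))) (\<phi> (greatest_tail s))"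
    by (auto simp: digit_node_bounds digit_hi_max)
qed

interpretation cf_tree: bridge_tree nodes node_child node_lo node_hi "1.002"
proof
  fix v and b
  assume "v \<in> nodes"
  then obtain \<phi> s j where v: "v = (\<phi>, s, j)" and \<phi>: "log_cylinder s \<phi>" and j: "1 \<le> j" "j < max_digit s"
    by (auto simp: nodes_def)
  show "node_child b v \<in> nodes"
    unfolding node_child_def v by (rule refine_in_nodes[OF \<phi> j])
  define \<alpha> x y \<beta> where "\<alpha> = digit_lo s j" and "x = digit_hi s j"
    and "y = digit_lo s (j + 1)" and "\<beta> = greatest_tail s"
  obtain r where r: "0 \<le> r" "s = S41 \<Longrightarrow> 0.8 \<le> r"
    "\<And>x y z. x \<in> tail_hull s \<Longrightarrow> y \<in> tail_hull s \<Longrightarrow> z \<in> tail_hull s \<Longrightarrow>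
      1.0145 * \<bar>y - x\<bar> * (z + r) \<le> \<bar>z - y\<bar> * (x + r) \<Longrightarrow>
      1.002 * \<bar>\<phi> y - \<phi> x\<bar> \<le> \<bar>\<phi> z - \<phi> y\<bar>"
    using log_cylinder_ratio[OF \<phi>] by blast
  have gap: "x < y" "1.0145 * (y - x) \<le> x - \<alpha>" "1.0145 * (y - x) * (\<beta> + r) \<le> (\<beta> - y) * (x + r)"
    unfolding \<alpha>_def x_def y_def \<beta>_def using digit_gap[OF j r(1,2)] by simp_all
  have order: "least_tail s \<le> \<alpha>" "\<alpha> < x" "y < \<beta>"
    unfolding \<alpha>_def x_def y_def \<beta>_def
    using digit_bounds[of j s] digit_bounds[of "j + 1" s] j by simp_all
  have hull: "\<alpha> \<in> tail_hull s" "x \<in> tail_hull s" "y \<in> tail_hull s" "\<beta> \<in> tail_hull s" "least_tail s \<in> tail_hull s"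
    using order gap(1) by (simp_all add: \<beta>_def)
  have right: "1.002 * \<bar>\<phi> y - \<phi> x\<bar> \<le> \<bar>\<phi> \<beta> - \<phi> y\<bar>"
    using gap order by (intro r(3) hull) simp
  \<comment> \<open>Since \<alpha> < y, the weights favour the left bridge, and the unweighted
    inequality is enough.\<close>
  have "1.0145 * (y - x) * (\<alpha> + r) \<le> (x - \<alpha>) * (y + r)"
    using gap order r least_tail_gt[of s] by (intro mult_mono) simp_all
  then have left: "1.002 * \<bar>\<phi> y - \<phi> x\<bar> \<le> \<bar>\<phi> x - \<phi> \<alpha>\<bar>"
    using gap order r(3)[OF hull(3,2,1)] by (simp add: abs_minus_commute)
  have F: "node_lo (refine False v) = min (\<phi> \<alpha>) (\<phi> x)" "node_hi (refine False v) = max (\<phi> \<alpha>) (\<phi> x)"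
    by (simp_all add: v digit_node_bounds \<alpha>_def x_def)
  have T: "node_lo (refine True v) = min (\<phi> y) (\<phi> \<beta>)" "node_hi (refine True v) = max (\<phi> y) (\<phi> \<beta>)"
    by (simp_all only: v refine_True_bounds[OF j(2)] y_def \<beta>_def)
  have N: "node_lo v = min (\<phi> \<alpha>) (\<phi> \<beta>)" "node_hi v = max (\<phi> \<alpha>) (\<phi> \<beta>)"
    by (simp_all add: v \<alpha>_def \<beta>_def)
  have inc: "increasing v \<longleftrightarrow> \<phi> (least_tail s) < \<phi> \<beta>" by (simp add: v \<beta>_def)
  have "least_tail s < \<beta>" using order gap(1) by linarith
  consider "increasing v" "\<phi> \<alpha> < \<phi> x" "\<phi> x < \<phi> y" "\<phi> y < \<phi> \<beta>"
    | "\<not> increasing v" "\<phi> \<beta> < \<phi> y" "\<phi> y < \<phi> x" "\<phi> x < \<phi> \<alpha>"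
  proof -
    show ?thesis
      using log_cylinder_mono[OF \<phi>]
    proof
      assume "\<forall>x\<in>tail_hull s. \<forall>y\<in>tail_hull s. x < y \<longrightarrow> \<phi> x < \<phi> y"
      then have "\<phi> u < \<phi> w" if "u \<in> tail_hull s" "w \<in> tail_hull s" "u < w" for u w
        using that by blast
      then show ?thesis
        using that(1) hull order gap(1) \<open>least_tail s < \<beta>\<close> unfolding inc by meson
    next
      assume "\<forall>x\<in>tail_hull s. \<forall>y\<in>tail_hull s. x < y \<longrightarrow> \<phi> y < \<phi> x"
      then have "\<phi> w < \<phi> u" if "u \<in> tail_hull s" "w \<in> tail_hull s" "u < w" for u w
        using that by blast
      then show ?thesis
        using that(2) hull order gap(1) \<open>least_tail s < \<beta>\<close> unfolding inc by (meson less_asym)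
    qed
  qed
  note orient = this
  show "node_lo (node_child False v) = node_lo v"
    by (rule orient) (simp_all add: node_child_def F T N)
  show "node_hi (node_child True v) = node_hi v"
    by (rule orient) (simp_all add: node_child_def F T N)
  show "node_hi (node_child False v) < node_lo (node_child True v)"
    by (rule orient) (simp_all add: node_child_def F T N)
  show "1.002 * (node_lo (node_child True v) - node_hi (node_child False v)) \<le> node_hi (node_child False v) - node_lo v"
    by (rule orient; use left right in \<open>simp add: node_child_def F T N\<close>)
  show "1.002 * (node_lo (node_child True v) - node_hi (node_child False v)) \<le> node_hi v - node_lo (node_child True v)"
    by (rule orient; use left right in \<open>simp add: node_child_def F T N\<close>)
qed simp

section \<open>Continued fractions read by the automaton\<close>

abbreviation shift :: "(nat \<Rightarrow> int) \<Rightarrow> nat \<Rightarrow> int" where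
  "shift a \<equiv> \<lambda>i. a (Suc i)"

lemma cf_convergent_bounds:
  assumes "\<And>i. 1 \<le> a i"
  shows "1 \<le> cf_convergent a n \<and> cf_convergent a n \<le> a 0 + 1"
  using assms
proof (induction n arbitrary: a)
  case (Suc n)
  have "1 \<le> cf_convergent (shift a) n" using Suc.IH[of "shift a"] Suc.prems by simp
  then have "0 \<le> 1 / cf_convergent (shift a) n" "1 / cf_convergent (shift a) n \<le> 1" by simp_all
  moreover have "1 \<le> real_of_int (a 0)" using Suc.prems[of 0] by simp
  ultimately show ?case unfolding cf_convergent.simps by linarith
qed simp

lemma regular_cf_expansion_bounds:
  assumes "regular_cf_expansion a x" "\<And>i. 1 \<le> a i"
  shows "1 \<le> x" "x \<le> a 0 + 1"
proof -
  have lim: "cf_convergent a \<longlonglongrightarrow> x" using assms(1) by (simp add: regular_cf_expansion_def)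
  have "1 \<le> cf_convergent a n \<and> cf_convergent a n \<le> a 0 + 1" for n
    by (rule cf_convergent_bounds[OF assms(2)])
  then show "1 \<le> x" "x \<le> a 0 + 1"
    using LIMSEQ_le_const[OF lim] LIMSEQ_le_const2[OF lim] by auto
qed

lemma regular_cf_expansion_shift:
  assumes "regular_cf_expansion a x" "\<And>i. 1 \<le> a i"
  obtains t where "x = a 0 + 1 / t" "1 \<le> t" "regular_cf_expansion (shift a) t"
proof -
  let ?c = "cf_convergent (shift a)"
  have c: "1 \<le> ?c n" "?c n \<le> a 1 + 1" for n
    using cf_convergent_bounds[of "shift a" n] assms(2) by auto
  have "(\<lambda>n. cf_convergent a (Suc n)) \<longlonglongrightarrow> x"
    using assms(1) unfolding regular_cf_expansion_def by (simp only: filterlim_sequentially_Suc)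
  then have "(\<lambda>n. cf_convergent a (Suc n) - a 0) \<longlonglongrightarrow> x - a 0"
    by (intro tendsto_intros)
  then have inv: "(\<lambda>n. 1 / ?c n) \<longlonglongrightarrow> x - a 0" by simp
  have a1: "0 < real_of_int (a 1 + 1)" using c[of 0] by linarith
  \<comment> \<open>This bound keeps the limit x - a 0 away from 0, so that the reciprocals converge
    as well.\<close>
  have "1 / (a 1 + 1) \<le> 1 / ?c n" for n
    using c[of n] by (intro divide_left_mono) auto
  then have "1 / (a 1 + 1) \<le> x - a 0"
    by (intro LIMSEQ_le_const[OF inv]) simp
  moreover have "0 < 1 / real_of_int (a 1 + 1)" using a1 by simp
  ultimately have pos: "0 < x - a 0" by linarith
  have "(\<lambda>n. 1 / (1 / ?c n)) \<longlonglongrightarrow> 1 / (x - a 0)"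
    using inv pos by (intro tendsto_divide tendsto_const) simp_all
  then have lim: "?c \<longlonglongrightarrow> 1 / (x - a 0)" by simp
  then have "regular_cf_expansion (shift a) (1 / (x - a 0))"
    using assms(2) by (simp add: regular_cf_expansion_def)
  moreover have "1 \<le> 1 / (x - a 0)"
    using c by (intro LIMSEQ_le_const[OF lim]) simp
  ultimately show ?thesis using that[of "1 / (x - a 0)"] by simp
qed

lemma regular_cf_expansion_Cons:
  assumes "regular_cf_expansion a t" "1 \<le> a 0" "1 \<le> t"
  shows "regular_cf_expansion (case_nat d a) (d + 1 / t)"
proof -
  have "1 \<le> a i" for i
    using assms by (cases "i = 0") (simp_all add: regular_cf_expansion_def)
  moreover have "cf_convergent a \<longlonglongrightarrow> t" using assms by (simp add: regular_cf_expansion_def)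
  then have "(\<lambda>n. d + 1 / cf_convergent a n) \<longlonglongrightarrow> d + 1 / t"
    using assms(3) by (intro tendsto_intros) simp_all
  then have "(\<lambda>n. cf_convergent (case_nat d a) (Suc n)) \<longlonglongrightarrow> d + 1 / t"
    by simp
  then have "cf_convergent (case_nat d a) \<longlonglongrightarrow> d + 1 / t"
    by (simp only: filterlim_sequentially_Suc)
  ultimately show ?thesis
    by (auto simp: regular_cf_expansion_def split: nat.splits)
qed

text \<open>The factor is 1/1.2: hull endpoints and hull elements exceed 1.2, while for convergents
  and for tails not yet located in a hull only 1 is known.\<close>

lemma abs_inverse_diff_le:
  fixes x y :: real
  assumes "1 \<le> x" "1.2 \<le> y"
  shows "\<bar>1 / x - 1 / y\<bar> \<le> 5 / 6 * \<bar>x - y\<bar>"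
proof -
  have pos: "0 < x" "0 < y" "1.2 \<le> x * y" using assms mult_mono[of 1 x "1.2" y] by auto
  have "\<bar>1 / x - 1 / y\<bar> = \<bar>x - y\<bar> / (x * y)"
    using pos by (simp add: diff_frac_eq abs_minus_commute)
  also have "\<dots> \<le> \<bar>x - y\<bar> / 1.2"
    using pos by (intro divide_left_mono) auto
  finally show ?thesis by simp
qed

section \<open>Admissible digit sequences and the tails they represent\<close>

fun run :: "state \<Rightarrow> (nat \<Rightarrow> int) \<Rightarrow> nat \<Rightarrow> state" where
  "run s a 0 = s"
| "run s a (Suc n) = run (step s (a 0)) (shift a) n"

lemma run_Suc: "run s a (Suc n) = step (run s a n) (a n)"
proof (induction n arbitrary: s a)
  case (Suc n)
  then show ?case by (metis run.simps(2))
qed simp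

definition readable :: "state \<Rightarrow> (nat \<Rightarrow> int) \<Rightarrow> bool" where
  "readable s a \<longleftrightarrow> (\<forall>n. 1 \<le> a n \<and> a n \<le> max_digit (run s a n))"

lemma readable_unfold:
  "readable s a \<longleftrightarrow> 1 \<le> a 0 \<and> a 0 \<le> max_digit s \<and> readable (step s (a 0)) (shift a)"
proof -
  have "(\<forall>n. P n) \<longleftrightarrow> P 0 \<and> (\<forall>n. P (Suc n))" for P :: "nat \<Rightarrow> bool"
    by (metis not0_implies_Suc)
  from this[of "\<lambda>n. 1 \<le> a n \<and> a n \<le> max_digit (run s a n)"]
  show ?thesis by (simp add: readable_def conj_assoc)
qed

lemma readable_pos: "readable s a \<Longrightarrow> 1 \<le> a i"
  by (simp add: readable_def)

lemma max_digit_le: "max_digit s \<le> 4"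
  by (simp add: max_digit_def)

text \<open>An infinite expansion offers no base case for exact hull membership. Instead the crude
  location in [1, 5] puts t within 5 of the hull, and each digit peeled off shrinks the error by
  5/6.\<close>

lemma readable_hull_approx:
  assumes "readable s a" "regular_cf_expansion a t"
  shows "least_tail s - 5 * (5 / 6) ^ k \<le> t \<and> t \<le> greatest_tail s + 5 * (5 / 6) ^ k"
  using assms
proof (induction k arbitrary: s a t)
  case 0
  have "a 0 \<le> 4" using readable_unfold[THEN iffD1, OF 0(1)] max_digit_le[of s] by linarith
  then have "real_of_int (a 0) \<le> 4" by simp
  then have "1 \<le> t" "t \<le> 5"
    using regular_cf_expansion_bounds[OF 0(2) readable_pos[OF 0(1)]] by simp_all
  then show ?case using least_tail_lt[of s] greatest_tail_gt[of s] by simp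
next
  case (Suc k)
  define d where "d = a 0"
  obtain u where u: "t = d + 1 / u" "1 \<le> u" "regular_cf_expansion (shift a) u"
    using regular_cf_expansion_shift[OF Suc.prems(2) readable_pos[OF Suc.prems(1)]] d_def by metis
  have d: "1 \<le> d" "d \<le> max_digit s" "readable (step s d) (shift a)"
    using readable_unfold[THEN iffD1, OF Suc.prems(1)] by (simp_all add: d_def)
  define e :: real where "e = 5 * (5 / 6) ^ k"
  let ?l = "least_tail (step s d)" and ?g = "greatest_tail (step s d)"
  have IH: "?l - e \<le> u" "u \<le> ?g + e"
    using Suc.IH[OF d(3) u(3)] by (simp_all add: e_def)
  have e: "0 \<le> e" by (simp add: e_def)
  have "1 / u \<le> 1 / ?l + 5 / 6 * e"
  proof (cases "?l \<le> u")
    case True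
    then have "1 / u \<le> 1 / ?l"
      using least_tail_gt[of "step s d"] by (intro divide_left_mono mult_pos_pos) auto
    then show ?thesis using e by linarith
  next
    case False
    then have "\<bar>u - ?l\<bar> \<le> e" using IH by simp
    moreover have "\<bar>1 / u - 1 / ?l\<bar> \<le> 5 / 6 * \<bar>u - ?l\<bar>"
      using u(2) least_tail_gt[of "step s d"] by (intro abs_inverse_diff_le) simp_all
    ultimately have "\<bar>1 / u - 1 / ?l\<bar> \<le> 5 / 6 * e"
      by (meson mult_left_mono order_trans zero_le_divide_iff zero_le_numeral)
    then show ?thesis by (simp only: abs_le_iff) linarith
  qed
  moreover have "1 / ?g - 5 / 6 * e \<le> 1 / u"
  proof (cases "u \<le> ?g")
    case True
    then have "1 / ?g \<le> 1 / u"
      using u(2) by (intro divide_left_mono mult_pos_pos) auto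
    then show ?thesis using e by linarith
  next
    case False
    then have "\<bar>u - ?g\<bar> \<le> e" using IH by simp
    moreover have "\<bar>1 / u - 1 / ?g\<bar> \<le> 5 / 6 * \<bar>u - ?g\<bar>"
      using u(2) greatest_tail_gt[of "step s d"] by (intro abs_inverse_diff_le) simp_all
    ultimately have "\<bar>1 / u - 1 / ?g\<bar> \<le> 5 / 6 * e"
      by (meson mult_left_mono order_trans zero_le_divide_iff zero_le_numeral)
    then show ?thesis by (simp only: abs_le_iff) linarith
  qed
  ultimately have "digit_lo s d - 5 / 6 * e \<le> t" "t \<le> digit_hi s d + 5 / 6 * e"
    unfolding digit_lo_def digit_hi_def u(1) by simp_all
  then show ?case using digit_bounds[OF d(1,2)] by (simp add: e_def)
qed

lemma readable_hull:
  assumes "readable s a" "regular_cf_expansion a t"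
  shows "t \<in> tail_hull s"
proof -
  have small: "\<exists>k. 5 * (5 / 6) ^ k < e" if "0 < e" for e :: real
    using real_arch_pow_inv[of "e / 5" "5 / 6"] that by (auto simp: field_simps)
  have "least_tail s \<le> t + e" "t \<le> greatest_tail s + e" if e: "0 < e" for e
  proof -
    obtain k where "5 * (5 / 6) ^ k < e" using small[OF e] by blast
    then show "least_tail s \<le> t + e" "t \<le> greatest_tail s + e"
      using readable_hull_approx[OF assms, of k] by simp_all
  qed
  then show ?thesis by (auto intro: field_le_epsilon)
qed

text \<open>Admissibility without a digit sequence: digits can be peeled off forever. The hull
  condition keeps every next tail above 1.2, which excludes division by zero and drives the descent
  and convergence arguments.\<close>

coinductive tail :: "state \<Rightarrow> real \<Rightarrow> bool" where
  tail_intro: "1 \<le> d \<Longrightarrow> d \<le> max_digit s \<Longrightarrow> t \<in> tail_hull (step s d) \<Longrightarrow> tail (step s d) t \<Longrightarrow>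
    tail s (real_of_int d + 1 / t)"

lemma readable_imp_tail:
  assumes "readable s a" "regular_cf_expansion a t"
  shows "tail s t"
proof -
  have "\<exists>a. readable s a \<and> regular_cf_expansion a t" using assms by blast
  then show ?thesis
  proof (coinduction arbitrary: s t)
    case tail
    then obtain a where a: "readable s a" "regular_cf_expansion a t" by blast
    obtain u where u: "t = a 0 + 1 / u" "regular_cf_expansion (shift a) u"
      using regular_cf_expansion_shift[OF a(2) readable_pos[OF a(1)]] by metis
    have d: "1 \<le> a 0" "a 0 \<le> max_digit s" "readable (step s (a 0)) (shift a)"
      using readable_unfold[THEN iffD1, OF a(1)] by simp_all
    with u show ?case using readable_hull[OF d(3) u(2)] by blast
  qed
qed

text \<open>Infinite descent as in Euclid's algorithm: if t = p/q = d + 1/u, then u = q/(p - d q),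
  and u > 1 makes the new denominator positive and smaller than q.\<close>

lemma tail_irrational:
  assumes "tail s t"
  shows "t \<notin> \<rat>"
proof
  assume "t \<in> \<rat>"
  then obtain p q :: int where "0 < q" "t = p / q"
    by (metis Rats_cases')
  with assms show False
  proof (induction "nat q" arbitrary: p q s t rule: less_induct)
    case less
    from less.prems(1) obtain d u where u: "t = of_int d + 1 / u" "u \<in> tail_hull (step s d)" "tail (step s d) u"
      by (auto elim: tail.cases)
    have "1 < u" using u(2) least_tail_gt[of "step s d"] by auto
    have frac: "real_of_int (p - d * q) = q / u"
      using u(1) less.prems(2,3) by (simp add: field_simps)
    moreover have "0 < q / u" "q / u < q"
      using \<open>1 < u\<close> less.prems(2) by (simp_all add: field_simps)
    ultimately have "0 < p - d * q" "p - d * q < q"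
      by (simp_all only: of_int_0_less_iff of_int_less_iff flip: of_int_0_less_iff of_int_less_iff[where ?'a = real])
    moreover have "u = q / real_of_int (p - d * q)"
      using frac \<open>1 < u\<close> less.prems(2) by simp
    ultimately show False
      using less.hyps[of "p - d * q" "step s d" u q] u(3) less.prems(2) by simp
  qed
qed

lemma tail_imp_readable:
  assumes "tail s t" "t \<in> tail_hull s"
  obtains a where "readable s a" "regular_cf_expansion a t"
proof -
  define ok where "ok \<sigma> \<longleftrightarrow> tail (fst \<sigma>) (snd \<sigma>) \<and> snd \<sigma> \<in> tail_hull (fst \<sigma>)" for \<sigma>
  have "\<exists>d \<sigma>'. 1 \<le> d \<and> d \<le> max_digit (fst \<sigma>) \<and> fst \<sigma>' = step (fst \<sigma>) d \<and>
      snd \<sigma> = of_int d + 1 / snd \<sigma>' \<and> ok \<sigma>'" if "ok \<sigma>" for \<sigma>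
  proof -
    have "tail (fst \<sigma>) (snd \<sigma>)" using that by (simp add: ok_def)
    then show ?thesis
    proof cases
      case (tail_intro d u)
      then show ?thesis by (intro exI[of _ d] exI[of _ "(step (fst \<sigma>) d, u)"]) (simp add: ok_def)
    qed
  qed
  then obtain f g where fg: "\<And>\<sigma>. ok \<sigma> \<Longrightarrow> 1 \<le> f \<sigma> \<and> f \<sigma> \<le> max_digit (fst \<sigma>) \<and>
      fst (g \<sigma>) = step (fst \<sigma>) (f \<sigma>) \<and> snd \<sigma> = of_int (f \<sigma>) + 1 / snd (g \<sigma>) \<and> ok (g \<sigma>)"
    by metis
  define digits where "digits \<sigma> n = f ((g ^^ n) \<sigma>)" for \<sigma> n
  have shift_digits: "shift (digits \<sigma>) = digits (g \<sigma>)" for \<sigma>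
    by (simp add: digits_def funpow_swap1 fun_eq_iff)
  have ok_funpow: "ok ((g ^^ n) \<sigma>)" if "ok \<sigma>" for n \<sigma>
    using that fg by (induction n) auto
  have digits_pos: "1 \<le> digits \<sigma> n" if "ok \<sigma>" for n \<sigma>
    using fg[OF ok_funpow[OF that]] by (simp add: digits_def)
  have "run (fst \<sigma>) (digits \<sigma>) n = fst ((g ^^ n) \<sigma>)" if "ok \<sigma>" for n \<sigma>
    using that
  proof (induction n arbitrary: \<sigma>)
    case (Suc n)
    have "digits \<sigma> 0 = f \<sigma>" by (simp add: digits_def)
    then show ?case
      using Suc.IH[of "g \<sigma>"] fg[OF Suc.prems] by (simp add: shift_digits funpow_swap1)
  qed simp
  then have "readable (fst \<sigma>) (digits \<sigma>)" if "ok \<sigma>" for \<sigma>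
    using that fg[OF ok_funpow] by (simp add: readable_def digits_def)
  \<comment> \<open>The zeroth convergent is the first digit, off by 1/u <= 1; every further layer
    contracts by 5/6.\<close>
  moreover have approx: "\<bar>cf_convergent (digits \<sigma>) n - snd \<sigma>\<bar> \<le> (5 / 6) ^ n" if "ok \<sigma>" for n \<sigma>
    using that
  proof (induction n arbitrary: \<sigma>)
    case 0
    have "1 \<le> snd (g \<sigma>)"
      using fg[OF 0] least_tail_gt[of "fst (g \<sigma>)"] unfolding ok_def by auto
    then show ?case using fg[OF 0] by (simp add: digits_def)
  next
    case (Suc n)
    let ?c = "cf_convergent (digits (g \<sigma>)) n" and ?u = "snd (g \<sigma>)"
    have okg: "ok (g \<sigma>)" using fg[OF Suc.prems] by blast
    have "1 \<le> ?c" using cf_convergent_bounds[of "digits (g \<sigma>)" n] digits_pos[OF okg] by blast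
    moreover have "1.2 \<le> ?u"
      using okg least_tail_gt[of "fst (g \<sigma>)"] unfolding ok_def by auto
    ultimately have "\<bar>1 / ?c - 1 / ?u\<bar> \<le> 5 / 6 * \<bar>?c - ?u\<bar>"
      by (rule abs_inverse_diff_le)
    also have "\<dots> \<le> 5 / 6 * (5 / 6) ^ n"
      using Suc.IH[OF okg] by simp
    finally have "\<bar>1 / ?c - 1 / ?u\<bar> \<le> (5 / 6) ^ Suc n" by simp
    moreover have "cf_convergent (digits \<sigma>) (Suc n) - snd \<sigma> = 1 / ?c - 1 / ?u"
      using fg[OF Suc.prems] by (simp add: shift_digits) (simp add: digits_def)
    ultimately show ?case by simp
  qed
  have "cf_convergent (digits \<sigma>) \<longlonglongrightarrow> snd \<sigma>" if "ok \<sigma>" for \<sigma>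
  proof -
    have "\<forall>\<^sub>F n in sequentially. norm (cf_convergent (digits \<sigma>) n - snd \<sigma>) \<le> (5 / 6) ^ n"
      using approx[OF that] by simp
    moreover have "(\<lambda>n. (5 / 6) ^ n) \<longlonglongrightarrow> (0 :: real)"
      by (rule LIMSEQ_realpow_zero) simp_all
    ultimately have "(\<lambda>n. cf_convergent (digits \<sigma>) n - snd \<sigma>) \<longlonglongrightarrow> 0"
      by (rule Lim_null_comparison)
    then show ?thesis by (rule LIM_zero_cancel)
  qed
  then have "regular_cf_expansion (digits \<sigma>) (snd \<sigma>)" if "ok \<sigma>" for \<sigma>
    using that digits_pos by (simp add: regular_cf_expansion_def)
  moreover have "ok (s, t)" using assms by (simp add: ok_def)
  ultimately show ?thesis using that[of "digits (s, t)"] by fastforce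
qed

text \<open>A state guarantees that its block has just been read. This turns a digit 4 refused by
  the automaton into an occurrence of a forbidden block.\<close>

lemma run_history:
  "case run S0 a n of
     S0 \<Rightarrow> True
   | S4 \<Rightarrow> \<exists>m. n = m + 1 \<and> a m = 4
   | S41 \<Rightarrow> \<exists>m. n = m + 2 \<and> a m = 4 \<and> a (m + 1) = 1
   | S414 \<Rightarrow> \<exists>m. n = m + 3 \<and> a m = 4 \<and> a (m + 1) = 1 \<and> a (m + 2) = 4
   | S4141 \<Rightarrow> \<exists>m. n = m + 4 \<and> a m = 4 \<and> a (m + 1) = 1 \<and> a (m + 2) = 4 \<and> a (m + 3) = 1"
proof (induction n)
  case (Suc n)
  then show ?case
    unfolding run_Suc
    by (cases "run S0 a n"; auto simp: step_def eval_nat_numeral)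
qed simp

lemma readable_iff:
  "readable S0 a \<longleftrightarrow> (\<forall>i. a i \<in> {1, 2, 3, 4} \<and> (a i, a (i + 1)) \<noteq> (4, 4) \<and>
     (a i, a (i + 1), a (i + 2), a (i + 3), a (i + 4)) \<noteq> (4, 1, 4, 1, 4))"
    (is "_ \<longleftrightarrow> (\<forall>i. ?D i \<and> ?P2 i \<and> ?P5 i)")
proof
  assume r: "readable S0 a"
  show "\<forall>i. ?D i \<and> ?P2 i \<and> ?P5 i"
  proof (intro allI conjI)
    fix i
    have le: "a n \<le> max_digit (run S0 a n)" for n
      using r by (simp add: readable_def)
    have "1 \<le> a i" "a i \<le> 4"
      using readable_pos[OF r] le[of i] max_digit_le[of "run S0 a i"] by auto
    then show "?D i" by auto
    have four: "run S0 a (i + 1) = S4 \<or> run S0 a (i + 1) = S414" if "a i = 4"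
      using that run_Suc[of S0 a i] by (simp add: step_def)
    then show "?P2 i"
      using le[of "i + 1"] by (auto simp: max_digit_def)
    show "?P5 i"
    proof
      assume "(a i, a (i + 1), a (i + 2), a (i + 3), a (i + 4)) = (4, 1, 4, 1, 4)"
      then have w: "a i = 4" "a (i + 1) = 1" "a (i + 2) = 4" "a (i + 3) = 1" "a (i + 4) = 4" by auto
      have R: "run S0 a (i + 2) = step (run S0 a (i + 1)) 1" "run S0 a (i + 3) = step (run S0 a (i + 2)) 4"
        "run S0 a (i + 4) = step (run S0 a (i + 3)) 1"
        using run_Suc[of S0 a "i + 1"] run_Suc[of S0 a "i + 2"] run_Suc[of S0 a "i + 3"] w
        by (simp_all add: eval_nat_numeral)
      \<comment> \<open>From \<open>S414\<close> the digit 1 would lead to \<open>S4141\<close>,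
        which already refuses the 4 at i + 2; so the state before was \<open>S4\<close>.\<close>
      have "run S0 a (i + 2) = S41"
        using four[OF w(1)] R(1) le[of "i + 2"] w(3) by (auto simp: step_def max_digit_def split: if_splits)
      then have "run S0 a (i + 4) = S4141" using R by (simp add: step_def)
      then show False using le[of "i + 4"] w(5) by (simp add: max_digit_def)
    qed
  qed
next
  assume P: "\<forall>i. ?D i \<and> ?P2 i \<and> ?P5 i"
  show "readable S0 a"
    unfolding readable_def
  proof (intro allI conjI)
    fix n
    have D: "?D n" and P2: "\<And>i. ?P2 i" and P5: "\<And>i. ?P5 i" using P by blast+
    show "1 \<le> a n" using D by auto
    show "a n \<le> max_digit (run S0 a n)"
    proof (cases "a n = 4")
      case True
      have "run S0 a n = S0 \<or> run S0 a n = S41"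
      proof (cases "run S0 a n")
        case S4
        with run_history[of n a] obtain m where "n = m + 1" "a m = 4" by auto
        then show ?thesis using P2[of m] True by simp
      next
        case S414
        with run_history[of n a] obtain m where "n = m + 3" "a (m + 2) = 4" by auto
        then show ?thesis using P2[of "m + 2"] True by (simp add: eval_nat_numeral)
      next
        case S4141
        with run_history[of n a] obtain m where "n = m + 4" "a m = 4" "a (m + 1) = 1" "a (m + 2) = 4" "a (m + 3) = 1" by auto
        then show ?thesis using P5[of m] True by simp
      qed simp_all
      then show ?thesis using True by (auto simp: max_digit_def)
    next
      case False
      then show ?thesis using D by (auto simp: max_digit_def)
    qed
  qed
qed

text \<open>The prefix 4, 3 leads from \<open>S0\<close> through \<open>S4\<close> back to
  \<open>S0\<close>, so the conditions on the whole sequence become those on the tail read from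
  \<open>S0\<close>.\<close>

lemma F4_star_eq: "F4_star = (\<lambda>t. 4 + 1 / (3 + 1 / t)) ` {t \<in> tail_hull S0. tail S0 t}"
proof (intro set_eqI iffI)
  fix x assume "x \<in> F4_star"
  then obtain a where a: "regular_cf_expansion a x" "a 0 = 4" "a 1 = 3" "readable S0 a"
    unfolding F4_star_def readable_iff by auto
  obtain u where u: "x = 4 + 1 / u" "regular_cf_expansion (shift a) u"
    using regular_cf_expansion_shift[OF a(1) readable_pos[OF a(4)]] a(2) by (metis of_int_numeral)
  have ru: "readable S4 (shift a)"
    using readable_unfold[THEN iffD1, OF a(4)] a(2) by (simp add: step_def)
  obtain t where t: "u = 3 + 1 / t" "regular_cf_expansion (shift (shift a)) t"
    using regular_cf_expansion_shift[OF u(2) readable_pos[OF ru]] a(3) by (metis One_nat_def of_int_numeral)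
  have rt: "readable S0 (shift (shift a))"
    using readable_unfold[THEN iffD1, OF ru] a(3) by (simp add: step_def)
  show "x \<in> (\<lambda>t. 4 + 1 / (3 + 1 / t)) ` {t \<in> tail_hull S0. tail S0 t}"
    using readable_hull[OF rt t(2)] readable_imp_tail[OF rt t(2)] u(1) t(1) by blast
next
  fix x assume "x \<in> (\<lambda>t. 4 + 1 / (3 + 1 / t)) ` {t \<in> tail_hull S0. tail S0 t}"
  then obtain t where t: "x = 4 + 1 / (3 + 1 / t)" "t \<in> tail_hull S0" "tail S0 t" by blast
  obtain a where a: "readable S0 a" "regular_cf_expansion a t"
    using tail_imp_readable[OF t(3,2)] by blast
  have "1 \<le> t" using t(2) least_tail_gt[of S0] by auto
  let ?b = "case_nat 3 a" and ?c = "case_nat 4 (case_nat 3 a)"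
  have "regular_cf_expansion ?b (3 + 1 / t)"
    using regular_cf_expansion_Cons[OF a(2) readable_pos[OF a(1)] \<open>1 \<le> t\<close>, of 3] by simp
  then have x: "regular_cf_expansion ?c x"
    using regular_cf_expansion_Cons[of ?b "3 + 1 / t" 4] \<open>1 \<le> t\<close> t(1) by simp
  have "readable S4 ?b"
    using a(1) by (subst readable_unfold) (simp add: step_def max_digit_def)
  then have c: "readable S0 ?c"
    by (subst readable_unfold) (simp add: step_def max_digit_def)
  have "x \<notin> \<rat>" using tail_irrational[OF readable_imp_tail[OF c x]] .
  moreover have "?c 0 = 4" "?c 1 = 3" by simp_all
  ultimately show "x \<in> F4_star"
    using x c unfolding F4_star_def readable_iff by (intro CollectI conjI exI[of _ ?c]) simp_all
qed

section \<open>Admissible tails are the points surviving in the tree\<close>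

definition first_digit_ge :: "state \<Rightarrow> int \<Rightarrow> real \<Rightarrow> bool" where
  "first_digit_ge s j t \<longleftrightarrow> (\<exists>d u. j \<le> d \<and> 1 \<le> d \<and> d \<le> max_digit s \<and>
     u \<in> tail_hull (step s d) \<and> tail (step s d) u \<and> t = of_int d + 1 / u)"

lemma tail_imp_first_digit_ge: "tail s t \<Longrightarrow> first_digit_ge s 1 t"
  unfolding first_digit_ge_def by (erule tail.cases) blast

lemma digit_lo_mono:
  assumes "j \<le> d"
  shows "digit_lo s j \<le> digit_lo s d"
proof (cases "j = d")
  case False
  then have "real_of_int j + 1 \<le> real_of_int d" using assms by simp
  moreover have "0 < 1 / greatest_tail (step s d)" "1 / greatest_tail (step s j) < 1"
    using greatest_tail_gt[of "step s d"] greatest_tail_gt[of "step s j"] by simp_all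
  ultimately show ?thesis unfolding digit_lo_def by linarith
qed simp

lemma log_cylinder_between:
  assumes "log_cylinder s \<phi>" "x \<in> tail_hull s" "y \<in> tail_hull s" "t \<in> tail_hull s" "x \<le> y"
  shows "\<phi> t \<in> {min (\<phi> x) (\<phi> y)..max (\<phi> x) (\<phi> y)} \<longleftrightarrow> t \<in> {x..y}"
  using log_cylinder_mono[OF assms(1)]
proof
  assume "\<forall>x\<in>tail_hull s. \<forall>y\<in>tail_hull s. x < y \<longrightarrow> \<phi> x < \<phi> y"
  then have "\<phi> u \<le> \<phi> w \<longleftrightarrow> u \<le> w" if "u \<in> tail_hull s" "w \<in> tail_hull s" for u w
    using that by (cases u w rule: linorder_cases) (force dest: less_imp_le)+
  then show ?thesis using assms(2-5) by (simp add: min_def max_def)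
next
  assume "\<forall>x\<in>tail_hull s. \<forall>y\<in>tail_hull s. x < y \<longrightarrow> \<phi> y < \<phi> x"
  then have "\<phi> w \<le> \<phi> u \<longleftrightarrow> u \<le> w" if "u \<in> tail_hull s" "w \<in> tail_hull s" for u w
    using that by (cases u w rule: linorder_cases) (force dest: less_imp_le)+
  then show ?thesis using assms(2-5) by (auto simp: min_def max_def)
qed

lemma tail_imp_remainder:
  assumes "log_cylinder s \<phi>" "tail s t"
  shows "\<phi> t \<in> cf_tree.remainder (\<phi>, s, 1)"
proof -
  define Q where "Q v y = (case v of (\<phi>, s, j) \<Rightarrow> \<exists>t. first_digit_ge s j t \<and> y = \<phi> t)" for v :: node and y
  show ?thesis
  proof (rule cf_tree.remainder_coinduct[where Q = Q])
    show "Q (\<phi>, s, 1) (\<phi> t)"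
      using tail_imp_first_digit_ge[OF assms(2)] by (auto simp: Q_def)
    show "(\<phi>, s, 1) \<in> nodes"
      using assms(1) by (simp add: nodes_def max_digit_def)
    fix v assume v: "v \<in> nodes" "Q v (\<phi> t)"
    obtain \<psi> s j where v_eq: "v = (\<psi>, s, j)" by (cases v)
    then have \<psi>: "log_cylinder s \<psi>" and j: "1 \<le> j" "j < max_digit s"
      using v(1) by (simp_all add: nodes_def)
    obtain w where w: "first_digit_ge s j w" "\<phi> t = \<psi> w" using v(2) by (auto simp: Q_def v_eq)
    then obtain d u where d: "j \<le> d" "1 \<le> d" "d \<le> max_digit s"
      and u: "u \<in> tail_hull (step s d)" "tail (step s d) u" "w = of_int d + 1 / u"
      unfolding first_digit_ge_def by blast
    have "w \<in> {digit_lo s j..greatest_tail s}"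
      using one_div_tail[OF u(1)] digit_bounds(3)[OF d(2,3)] digit_lo_mono[OF d(1), of s] u(3) by auto
    moreover have "least_tail s \<le> digit_lo s j" "digit_lo s j \<le> greatest_tail s"
      using digit_bounds[of j s] j by auto
    ultimately have hull: "\<psi> w \<in> {node_lo v..node_hi v}"
      unfolding v_eq node_lo.simps node_hi.simps
      by (subst log_cylinder_between[OF \<psi>]) auto
    have digit: "Q (digit_node \<psi> s d) (\<psi> w)"
      using tail_imp_first_digit_ge[OF u(2)] u(3) by (auto simp: Q_def digit_node_def)
    have "\<exists>c. Q (refine c v) (\<psi> w)"
    proof (cases "d = j")
      case True
      then show ?thesis using digit by (intro exI[of _ False]) (simp add: v_eq)
    next
      case False
      show ?thesis
      proof (cases "j + 1 < max_digit s")
        case True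
        have "first_digit_ge s (j + 1) w"
          unfolding first_digit_ge_def using False d u by (intro exI[of _ d] exI[of _ u]) simp
        then show ?thesis using True by (intro exI[of _ True]) (auto simp: v_eq Q_def)
      next
        case last: False
        then have "d = j + 1" using d j False by linarith
        then show ?thesis using digit last by (intro exI[of _ True]) (simp add: v_eq)
      qed
    qed
    then obtain c where "Q (refine c v) (\<psi> w)" by blast
    \<comment> \<open>Relabelling by orientation is an involution, so every refinement is a
      child.\<close>
    moreover have "((c = increasing v) = increasing v) = c" by blast
    ultimately have "Q (node_child (c = increasing v) v) (\<psi> w)"
      by (simp add: node_child_def)
    then show "\<phi> t \<in> {node_lo v..node_hi v} \<and> (\<exists>b. Q (node_child b v) (\<phi> t))"
      using hull w(2) by auto
  qed
qed

text \<open>Several binary splits make up one digit; induction on the number of digits left follows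
  the surviving point until it enters the cylinder of its digit.\<close>

lemma remainder_digit:
  assumes "log_cylinder s \<phi>" "1 \<le> j" "j < max_digit s" "t \<in> tail_hull s"
    "\<phi> t \<in> cf_tree.remainder (\<phi>, s, j)"
  shows "\<exists>d. 1 \<le> d \<and> d \<le> max_digit s \<and> t \<in> {digit_lo s d..digit_hi s d} \<and>
    \<phi> t \<in> cf_tree.remainder (digit_node \<phi> s d)"
  using assms
proof (induction "nat (max_digit s - j)" arbitrary: j rule: less_induct)
  case less
  have digit: "t \<in> {digit_lo s d..digit_hi s d}"
    if "1 \<le> d" "d \<le> max_digit s" "\<phi> t \<in> cf_tree.remainder (digit_node \<phi> s d)" for d
  proof -
    have "\<phi> t \<in> {node_lo (digit_node \<phi> s d)..node_hi (digit_node \<phi> s d)}"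
      using that(3) by (simp add: cf_tree.remainder_def)
    then show ?thesis
      unfolding digit_node_bounds
      using digit_bounds[OF that(1,2)] less.prems(4)
      by (subst (asm) log_cylinder_between[OF less.prems(1)]) auto
  qed
  have v: "(\<phi>, s, j) \<in> nodes" using less.prems by (simp add: nodes_def)
  obtain c where c: "\<phi> t \<in> cf_tree.remainder (refine c (\<phi>, s, j))"
    using cf_tree.remainder_child[OF v less.prems(5)] unfolding node_child_def by blast
  show ?case
  proof (cases c)
    case False
    then have "\<phi> t \<in> cf_tree.remainder (digit_node \<phi> s j)" using c by simp
    then show ?thesis using digit[of j] less.prems by (intro exI[of _ j]) simp
  next
    case True
    show ?thesis
    proof (cases "j + 1 < max_digit s")
      case step: True
      then show ?thesis
        using c True less.prems less.hyps[of "j + 1"] by simp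
    next
      case False
      then have "\<phi> t \<in> cf_tree.remainder (digit_node \<phi> s (j + 1))" using c True by simp
      then show ?thesis using digit[of "j + 1"] less.prems by (intro exI[of _ "j + 1"]) simp
    qed
  qed
qed

text \<open>The cylinder map changes with every digit, so the coinduction hides it behind an
  existential; the next tail is 1/(t - d), at which the refined map takes the same value.\<close>

lemma remainder_imp_tail:
  assumes "log_cylinder s \<phi>" "t \<in> tail_hull s" "\<phi> t \<in> cf_tree.remainder (\<phi>, s, 1)"
  shows "tail s t"
proof -
  have "t \<in> tail_hull s \<and> (\<exists>\<phi>. log_cylinder s \<phi> \<and> \<phi> t \<in> cf_tree.remainder (\<phi>, s, 1))"
    using assms by blast
  then show ?thesis
  proof (coinduction arbitrary: s t)
    case tail
    then obtain \<phi> where \<phi>: "log_cylinder s \<phi>" "\<phi> t \<in> cf_tree.remainder (\<phi>, s, 1)" and t: "t \<in> tail_hull s"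
      by blast
    have "1 < max_digit s" by (simp add: max_digit_def)
    then obtain d where d: "1 \<le> d" "d \<le> max_digit s" "t \<in> {digit_lo s d..digit_hi s d}"
      "\<phi> t \<in> cf_tree.remainder (digit_node \<phi> s d)"
      using remainder_digit[OF \<phi>(1) _ _ t \<phi>(2)] by auto
    define u where "u = 1 / (t - d)"
    let ?l = "least_tail (step s d)" and ?g = "greatest_tail (step s d)"
    have pos: "0 < ?l" "0 < ?g" using least_tail_gt[of "step s d"] greatest_tail_gt[of "step s d"] by simp_all
    have bds: "1 / ?g \<le> t - d" "t - d \<le> 1 / ?l"
      using d(3) by (auto simp: digit_lo_def digit_hi_def)
    moreover have "0 < 1 / ?g" using pos by simp
    ultimately have "0 < t - d" by linarith
    then have "u \<in> tail_hull (step s d)"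
      using bds pos by (simp add: u_def field_simps)
    moreover have "t = of_int d + 1 / u" by (simp add: u_def)
    moreover have "log_cylinder (step s d) (\<lambda>t. \<phi> (d + 1 / t))"
      using log_cylinder_step[OF \<phi>(1) d(1,2)] .
    ultimately show ?case
      using d(1,2,4) unfolding digit_node_def by blast
  qed
qed

theorem theorem2p14:
  shows "\<exists>\<tau>>1. thickness_at_least (ln ` F4_star) \<tau>"
proof -
  define \<phi> where "\<phi> t = ln (4 + 1 / (3 + 1 / t))" for t :: real
  have \<phi>: "log_cylinder S0 \<phi>" unfolding \<phi>_def by (rule log_cylinder_root)
  have v: "(\<phi>, S0, 1) \<in> nodes" using \<phi> by (simp add: nodes_def max_digit_def)
  have "ln ` F4_star = \<phi> ` {t \<in> tail_hull S0. tail S0 t}"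
    by (simp add: F4_star_eq image_image \<phi>_def)
  also have "\<dots> = cf_tree.remainder (\<phi>, S0, 1)"
  proof (intro set_eqI iffI)
    fix y assume "y \<in> \<phi> ` {t \<in> tail_hull S0. tail S0 t}"
    then show "y \<in> cf_tree.remainder (\<phi>, S0, 1)" using tail_imp_remainder[OF \<phi>] by blast
  next
    fix y assume y: "y \<in> cf_tree.remainder (\<phi>, S0, 1)"
    have bds: "0 < least_tail S0" "least_tail S0 \<le> greatest_tail S0"
      using least_tail_bounds greatest_tail_bounds by simp_all
    \<comment> \<open>A surviving y is so far only a real number in the root hull; the intermediate
      value theorem provides the tail t with \<phi> t = y.\<close>
    have "continuous_on (tail_hull S0) (\<lambda>t. 4 + 1 / (3 + 1 / t))"
    proof (intro continuous_intros ballI)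
      fix t assume "t \<in> tail_hull S0"
      then have "0 < t" using bds by auto
      then show "t \<noteq> 0" "3 + 1 / t \<noteq> 0" by (simp_all add: add_pos_pos less_imp_neq[THEN not_sym])
    qed
    moreover have pos: "0 < 4 + 1 / (3 + 1 / t)" if "t \<in> tail_hull S0" for t :: real
      using that bds by (auto intro!: add_pos_pos divide_pos_pos)
    ultimately have cont: "continuous_on (tail_hull S0) \<phi>"
      unfolding \<phi>_def by (intro continuous_on_ln) (auto dest: pos)
    have "1 / greatest_tail S0 \<le> 1 / least_tail S0"
      using bds by (simp add: frac_le)
    then have "4 + 1 / (3 + 1 / least_tail S0) \<le> 4 + 1 / (3 + 1 / greatest_tail S0)"
      using bds by (intro add_left_mono divide_left_mono mult_pos_pos add_pos_pos) auto
    then have "\<phi> (least_tail S0) \<le> \<phi> (greatest_tail S0)"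
      unfolding \<phi>_def using pos[of "least_tail S0"] pos[of "greatest_tail S0"] bds by simp
    then have "\<phi> (least_tail S0) \<le> y" "y \<le> \<phi> (greatest_tail S0)"
      using y by (simp_all add: cf_tree.remainder_def digit_lo_1)
    then obtain t where t: "t \<in> tail_hull S0" "\<phi> t = y"
      using IVT'[of \<phi> "least_tail S0" y "greatest_tail S0"] cont bds by auto
    then show "y \<in> \<phi> ` {t \<in> tail_hull S0. tail S0 t}"
      using remainder_imp_tail[OF \<phi> t(1)] y by blast
  qed
  finally have "thickness_at_least (ln ` F4_star) 1.002"
    using cf_tree.thickness_remainder[OF v] by simp
  then show ?thesis by (intro exI[of _ "1.002"]) simp
qed

end
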